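(* For every $j\in\{1,\dots,\ell\}$ and every prior $\pi\in\mathrm{int}(I_j)$, it holds that $\hat v(\pi)=v^*_0(\pi)$ if and only if either $v^*_0(\pi)=v(\pi)$ (that is, $v^*_0(\pi)$ is trivially supported), or $v^*_0(\pi)=u_S(a_i)$ for $i=1$ or for $i=\ell$.
   Context: **Model.** The state space is $\Omega=\{0,1\}$ with common prior $\pi=\mathbf{P}(\omega=1)\in(0,1)$. The receiver has a finite action set $A=\{a_1,\dots,a_\ell\}$ and a utility $u_R:A\times\Omega\to\mathbb{R}$ and maximizes expected utility. There are cutoffs $0=x_0<x_1<\dots<x_\ell=1$ such that the set of beliefs (probabilities of $\omega=1$) at which $a_i$ is optimal is $I_i=[x_{i-1},x_i]$. The sender has a state-independent utility $u_S:A\to\mathbb{R}$ (extended linearly to $\Delta(A)$) that is generic: $u_S(a)\neq u_S(b)$ for distinct $a,b\in A$. For a belief $\lambda$, $v(\lambda)\subset\mathbb{R}$ is the set of all possible sender utilities when the receiver best-replies to $\lambda$ (possibly mixing); if $\lambda\in\mathrm{int}(I_i)$ then $v(\lambda)$ is the single value $u_S(a_i)$ and is identified with it. **Information structures.** An information structure $F=(S,F_0,F_1)$ consists of a measurable space $S$ and two mutually absolutely continuous probability measures $F_0,F_1$ on $S$ (the distribution of the receiver's private signal in each state). Each signal $s$ is identified with the posterior probability of $\omega=1$ that it induces starting from prior $1/2$, so $S\subseteq(0,1)$. With $lr(\lambda)=\log\frac{\lambda}{1-\lambda}$, a belief $\lambda$ is updated after signal $s$ to $\lambda^s$ with $lr(\lambda^s)=lr(\lambda)+lr(s)$.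 The sender does not observe the receiver's signal; message and signal are conditionally independent given $\omega$. For $\delta>0$, $\mathcal F_\delta$ is the set of all information structures with support contained in $[\frac12-\delta,\frac12+\delta]$. **Equilibrium.** A sender strategy is $\sigma:\Omega\to\Delta(M)$ with $M\subseteq[0,1]$ finite; a receiver strategy is a measurable $\rho:M\times S\to\Delta(A)$. Together with $F$ and $\pi$ they generate a distribution $p$ on $\Omega\times M\times S$; messages are identified with the posteriors they induce, $p(\omega=1|m)=m$. The pair $(\sigma,\rho)$ is a cheap-talk equilibrium if (1) the support of $\rho(m,s)$ is contained in $\arg\max_{a\in A}\,p(\omega=1|m,s)u_R(a,1)+p(\omega=0|m,s)u_R(a,0)$; and (2) for every $m\in M$ and $\omega\in\Omega$ with $p(m|\omega)>0$, $\int_S u_S(\rho(m,s))\,dF_\omega(s)\ge\int_S u_S(\rho(m',s))\,dF_\omega(s)$ for every $m'$ that is sent with positive probability. **Values.** $v^*_F(\pi)$ is the sender's maximal ex-ante expected utility over all cheap-talk equilibria with information structure $F$ and prior $\pi$. $v_0^*(\pi)$ is this value when $F$ is uninformative; it is known (Lipnowski and Ravid) that $v^*_0(\pi)=\min\{\max_{\lambda\le\pi}v(\lambda),\max_{\mu\ge\pi}v(\mu)\}$, where $\max v$ denotes the largest element over the sets $v(\cdot)$. The informationally robust equilibrium utility is $\hat v(\pi)=\lim_{\delta\to0}\inf_{F\in\mathcal F_\delta}v^*_F(\pi)$. *)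

theory Defs
  imports "HOL-Probability.Probability"
begin

text \<open>
  The state space is \<^typ>\<open>bool\<close>, with \<^const>\<open>True\<close> playing the role of state 1; a belief is the
  probability of \<^const>\<open>True\<close>.
\<close>

definition weight :: "real \<Rightarrow> bool \<Rightarrow> real" where
  "weight q \<omega> = (if \<omega> then q else 1 - q)"

definition lr :: "real \<Rightarrow> real" where
  "lr q = ln (q / (1 - q))"

text \<open>
  The posterior of belief \<open>q\<close> after a signal \<open>s\<close> in the open unit interval. The closed form is
  the solution of the log-likelihood-ratio equation \<open>lr_update\<close> below for interior \<open>q\<close>, and also
  covers the degenerate beliefs 0 and 1, which no signal can move.
\<close>

definition update :: "real \<Rightarrow> real \<Rightarrow> real" where
  "update q s = q * s / (q * s + (1 - q) * (1 - s))"

lemma lr_update: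
  assumes "0 < q" "q < 1" "0 < s" "s < 1"
  shows "lr (update q s) = lr q + lr s"
proof -
  have pos: "0 < q * s" "0 < (1 - q) * (1 - s)"
    using assms by simp_all
  then have "1 - update q s = (1 - q) * (1 - s) / (q * s + (1 - q) * (1 - s))"
    by (simp add: update_def field_simps)
  then have "update q s / (1 - update q s) = (q * s) / ((1 - q) * (1 - s))"
    using pos by (simp add: update_def)
  then have "update q s / (1 - update q s) = (q / (1 - q)) * (s / (1 - s))"
    by simp
  then have "lr (update q s) = ln ((q / (1 - q)) * (s / (1 - s)))"
    by (simp only: lr_def)
  also have "\<dots> = lr q + lr s"
    unfolding lr_def using assms by (intro ln_mult_pos) simp_all
  finally show ?thesis .
qed

definition receiver_utility :: "('a \<Rightarrow> bool \<Rightarrow> real) \<Rightarrow> real \<Rightarrow> 'a \<Rightarrow> real" where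
  "receiver_utility uR q b = (\<Sum>\<omega>\<in>UNIV. weight q \<omega> * uR b \<omega>)"

definition best_replies :: "'a set \<Rightarrow> ('a \<Rightarrow> bool \<Rightarrow> real) \<Rightarrow> real \<Rightarrow> 'a set" where
  "best_replies A uR q =
     {b \<in> A. \<forall>c\<in>A. receiver_utility uR q c \<le> receiver_utility uR q b}"

abbreviation mixed_utility :: "('a \<Rightarrow> real) \<Rightarrow> 'a pmf \<Rightarrow> real" where
  "mixed_utility uS \<alpha> \<equiv> measure_pmf.expectation \<alpha> uS"

definition sender_values ::
    "'a set \<Rightarrow> ('a \<Rightarrow> bool \<Rightarrow> real) \<Rightarrow> ('a \<Rightarrow> real) \<Rightarrow> real \<Rightarrow> real set" where
  "sender_values A uR uS q = {mixed_utility uS \<alpha> | \<alpha>. set_pmf \<alpha> \<subseteq> best_replies A uR q}"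

text \<open>
  An information structure is given by \<open>F \<omega>\<close>, the distribution of the signal in state \<open>\<omega>\<close>; the
  signal space \<open>S\<close> is the common underlying measurable space. Signals are identified with
  the posteriors they induce from prior 1/2: the last clause is the defining property of
  the conditional probability of state 1 given the signal. The sigma-algebra may be finer than
  the Borel one, but the posterior has to be measurable.
\<close>

definition info_structure :: "(bool \<Rightarrow> real measure) \<Rightarrow> bool" where
  "info_structure F \<longleftrightarrow>
     prob_space (F False) \<and> prob_space (F True) \<and>
     sets (F True) = sets (F False) \<and>
     absolutely_continuous (F False) (F True) \<and> absolutely_continuous (F True) (F False) \<and>
     space (F False) \<subseteq> {0<..<1} \<and>
     (\<lambda>s. s) \<in> borel_measurable (F False) \<and>
     (\<forall>B\<in>sets (F False).
        1/2 * measure (F True) B =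
        1/2 * (LINT s:B|F False. s) + 1/2 * (LINT s:B|F True. s))"

definition support :: "real measure \<Rightarrow> real set" where
  "support N = {s. \<forall>U. open U \<and> s \<in> U \<longrightarrow> 0 < emeasure N (U \<inter> space N)}"

definition near_uninformative :: "real \<Rightarrow> (bool \<Rightarrow> real measure) set" where
  "near_uninformative \<delta> =
     {F. info_structure F \<and> (\<forall>\<omega>. support (F \<omega>) \<subseteq> {1/2 - \<delta>..1/2 + \<delta>})}"

definition uninformative :: "bool \<Rightarrow> real measure" where
  "uninformative \<omega> = return (count_space {1/2}) (1/2)"

lemma info_structure_uninformative: "info_structure uninformative"
proof -
  have "B = {} \<or> B = {1/2}" if "B \<subseteq> {1/2::real}" for B
    using that by blast
  then show ?thesis
    unfolding info_structure_def uninformative_def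
    by (auto simp: absolutely_continuous_def set_lebesgue_integral_def integral_return
        measure_return intro!: prob_space_return)
qed

definition message_prob :: "real \<Rightarrow> (bool \<Rightarrow> real pmf) \<Rightarrow> real \<Rightarrow> real" where
  "message_prob \<pi> \<sigma> m = (\<Sum>\<omega>\<in>UNIV. weight \<pi> \<omega> * pmf (\<sigma> \<omega>) m)"

text \<open>
  Messages that are sent with positive probability coincide with the posteriors they induce.
  Since message and signal are conditionally independent given the state, the belief
  after \<open>m\<close> and \<open>s\<close> is \<^term>\<open>update m s\<close>.
\<close>

definition sender_strategy :: "real \<Rightarrow> real set \<Rightarrow> (bool \<Rightarrow> real pmf) \<Rightarrow> bool" where
  "sender_strategy \<pi> M \<sigma> \<longleftrightarrow>
     finite M \<and> M \<subseteq> {0..1} \<and> (\<forall>\<omega>. set_pmf (\<sigma> \<omega>) \<subseteq> M) \<and>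
     (\<forall>m\<in>M. message_prob \<pi> \<sigma> m > 0 \<longrightarrow> \<pi> * pmf (\<sigma> True) m / message_prob \<pi> \<sigma> m = m)"

definition receiver_strategy ::
    "'a set \<Rightarrow> (bool \<Rightarrow> real measure) \<Rightarrow> real set \<Rightarrow> (real \<Rightarrow> real \<Rightarrow> 'a pmf) \<Rightarrow> bool" where
  "receiver_strategy A F M \<rho> \<longleftrightarrow>
     (\<forall>m\<in>M. \<forall>s\<in>space (F False). set_pmf (\<rho> m s) \<subseteq> A) \<and>
     (\<forall>m\<in>M. \<forall>b\<in>A. (\<lambda>s. pmf (\<rho> m s) b) \<in> borel_measurable (F False))"

definition interim_utility ::
    "('a \<Rightarrow> real) \<Rightarrow> (bool \<Rightarrow> real measure) \<Rightarrow> (real \<Rightarrow> real \<Rightarrow> 'a pmf) \<Rightarrow> bool \<Rightarrow> real \<Rightarrow> real" where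
  "interim_utility uS F \<rho> \<omega> m = (LINT s|F \<omega>. mixed_utility uS (\<rho> m s))"

definition cheap_talk_equilibrium ::
    "'a set \<Rightarrow> ('a \<Rightarrow> bool \<Rightarrow> real) \<Rightarrow> ('a \<Rightarrow> real) \<Rightarrow> (bool \<Rightarrow> real measure) \<Rightarrow> real \<Rightarrow>
     real set \<Rightarrow> (bool \<Rightarrow> real pmf) \<Rightarrow> (real \<Rightarrow> real \<Rightarrow> 'a pmf) \<Rightarrow> bool" where
  "cheap_talk_equilibrium A uR uS F \<pi> M \<sigma> \<rho> \<longleftrightarrow>
     sender_strategy \<pi> M \<sigma> \<and> receiver_strategy A F M \<rho> \<and>
     (\<forall>m\<in>M. \<forall>s\<in>space (F False). set_pmf (\<rho> m s) \<subseteq> best_replies A uR (update m s)) \<and>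
     (\<forall>m\<in>M. \<forall>\<omega>. pmf (\<sigma> \<omega>) m > 0 \<longrightarrow>
        (\<forall>m'\<in>M. message_prob \<pi> \<sigma> m' > 0 \<longrightarrow>
           interim_utility uS F \<rho> \<omega> m \<ge> interim_utility uS F \<rho> \<omega> m'))"

definition ex_ante_utility ::
    "('a \<Rightarrow> real) \<Rightarrow> (bool \<Rightarrow> real measure) \<Rightarrow> real \<Rightarrow>
     real set \<Rightarrow> (bool \<Rightarrow> real pmf) \<Rightarrow> (real \<Rightarrow> real \<Rightarrow> 'a pmf) \<Rightarrow> real" where
  "ex_ante_utility uS F \<pi> M \<sigma> \<rho> =
     (\<Sum>\<omega>\<in>UNIV. weight \<pi> \<omega> * (\<Sum>m\<in>M. pmf (\<sigma> \<omega>) m * interim_utility uS F \<rho> \<omega> m))"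

text \<open>
  The maximum over equilibria is written as a supremum; since \<open>A\<close> is finite, the set of
  equilibrium utilities is bounded.
\<close>

definition equilibrium_value ::
    "'a set \<Rightarrow> ('a \<Rightarrow> bool \<Rightarrow> real) \<Rightarrow> ('a \<Rightarrow> real) \<Rightarrow> (bool \<Rightarrow> real measure) \<Rightarrow> real \<Rightarrow> real" where
  "equilibrium_value A uR uS F \<pi> =
     Sup {ex_ante_utility uS F \<pi> M \<sigma> \<rho> | M \<sigma> \<rho>. cheap_talk_equilibrium A uR uS F \<pi> M \<sigma> \<rho>}"

definition uninformed_value ::
    "'a set \<Rightarrow> ('a \<Rightarrow> bool \<Rightarrow> real) \<Rightarrow> ('a \<Rightarrow> real) \<Rightarrow> real \<Rightarrow> real" where
  "uninformed_value A uR uS \<pi> = equilibrium_value A uR uS uninformative \<pi>"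

definition robust_value ::
    "'a set \<Rightarrow> ('a \<Rightarrow> bool \<Rightarrow> real) \<Rightarrow> ('a \<Rightarrow> real) \<Rightarrow> real \<Rightarrow> real" where
  "robust_value A uR uS \<pi> =
     Lim (at_right 0) (\<lambda>\<delta>. INF F\<in>near_uninformative \<delta>. equilibrium_value A uR uS F \<pi>)"

end

theory Submission
  imports Defs
begin

text \<open>
  In each state, all equilibrium messages with an interior posterior give the sender the same
  interim utility, since they are sent in both states. Write \<open>L\<close> and \<open>R\<close> for the largest utility of an action that is optimal at some belief
  below, respectively above, the prior; the uninformed value is \<open>V = min L R\<close>.

  If \<open>V\<close> is the utility at the prior, babbling achieves it robustly. If \<open>V\<close> comes from an extreme
  action, one message reveals the corresponding state, so that its utility does not depend on the
  receiver's signal; the other message lies close to a cutoff and is calibrated by a quantile of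
  the signal to give utility \<open>V\<close> in the revealed state, and it is at least as good in the other state
  because signals are ordered by first-order stochastic dominance.

  Otherwise, let the signal be binary with posteriors \<open>1/2 - d\<close> and \<open>1/2 + d\<close>. Two interior messages
  on the two sides of the prior have equal interim utilities in both states, hence equal utilities
  after each signal, all at most \<open>V\<close>. Each of the messages induces a pure action after at least
  one of the two signals, and these actions cannot both give \<open>V\<close>. So the sender loses a constant fraction of
  a gap between utility levels, however small \<open>d\<close> is.
\<close>

subsection \<open>Beliefs and signals\<close>

lemma update_bounds:
  assumes "q \<in> {0..1}" "s \<in> {0<..<1}"
  shows "update q s \<in> {0..1}"
proof -
  have "0 \<le> q * s" "0 \<le> (1 - q) * (1 - s)" using assms by auto
  then show ?thesis
    unfolding update_def by (auto intro!: divide_nonneg_nonneg simp: divide_le_eq_1)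
qed

lemma update_extreme [simp]:
  "s \<noteq> 0 \<Longrightarrow> update 1 s = 1" "update 0 s = 0"
  by (simp_all add: update_def)

lemma update_half [simp]: "update q (1/2) = q"
  by (simp add: update_def field_simps)

lemma update_denominator_pos:
  fixes q s :: real
  assumes "q \<in> {0..1}" "s \<in> {0<..<1}"
  shows "0 < q * s + (1 - q) * (1 - s)"
proof (cases "q = 0")
  case True
  then show ?thesis using assms by simp
next
  case False
  then have "0 < q * s" "0 \<le> (1 - q) * (1 - s)" using assms by auto
  then show ?thesis by linarith
qed

text \<open>The denominator is a convex combination of \<open>s\<close> and \<open>1 - s\<close>,
  hence at least 1/4, while \<open>q * (1 - q)\<close> is at most 1/4. So a weak signal moves all
  beliefs little, uniformly in \<open>q\<close>.\<close>

lemma abs_update_diff_le: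
  assumes q: "q \<in> {0..1}" and s: "\<bar>s - 1/2\<bar> \<le> 1/4"
  shows "\<bar>update q s - q\<bar> \<le> 2 * \<bar>s - 1/2\<bar>"
proof -
  let ?D = "q * s + (1 - q) * (1 - s)"
  have s': "s \<in> {1/4..3/4}" using s unfolding abs_le_iff by simp
  have "q * (1/4) + (1 - q) * (1/4) \<le> ?D"
    using q s' by (intro add_mono mult_left_mono) auto
  moreover have "q * (1/4) + (1 - q) * (1/4) = 1/4" by (simp add: field_simps)
  ultimately have D: "1/4 \<le> ?D" by linarith
  have "update q s - q = q * (1 - q) * (2 * s - 1) / ?D"
    using D by (simp add: update_def field_simps)
  then have "\<bar>update q s - q\<bar> = q * (1 - q) * \<bar>2 * s - 1\<bar> / ?D"
    using q D by (simp add: abs_mult abs_divide)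
  also have "\<dots> \<le> (1/4) * \<bar>2 * s - 1\<bar> / (1/4)"
  proof (intro frac_le mult_right_mono)
    have "0 \<le> (q - 1/2)\<^sup>2" by simp
    then show "q * (1 - q) \<le> 1/4" by (simp add: power2_eq_square algebra_simps)
  qed (use D in auto)
  finally show ?thesis by (simp add: abs_if split: if_splits)
qed

lemma update_near:
  assumes "q \<in> {0..1}" "\<bar>s - 1/2\<bar> \<le> \<delta>" "\<delta> \<le> 1/4"
  shows "\<bar>update q s - q\<bar> \<le> 2 * \<delta>"
proof -
  have "\<bar>s - 1/2\<bar> \<le> 1/4" using assms by linarith
  then have "\<bar>update q s - q\<bar> \<le> 2 * \<bar>s - 1/2\<bar>" by (rule abs_update_diff_le[OF assms(1)])
  also have "\<dots> \<le> 2 * \<delta>" using assms(2) by (intro mult_left_mono) auto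
  finally show ?thesis .
qed

text \<open>After cross-multiplication the two sides differ by \<open>q * (1 - q) * (t - s)\<close>,
  which is positive exactly because \<open>q\<close> is interior and \<open>s < t\<close>.\<close>

lemma update_strict_mono:
  assumes q: "q \<in> {0<..<1}" and "s \<in> {0<..<1}" "t \<in> {0<..<1}" and "s < t"
  shows "update q s < update q t"
proof -
  have D: "0 < q * s + (1 - q) * (1 - s)" "0 < q * t + (1 - q) * (1 - t)"
    using assms by (auto intro!: update_denominator_pos)
  have "q * t * (q * s + (1 - q) * (1 - s)) - q * s * (q * t + (1 - q) * (1 - t))
      = q * (1 - q) * (t - s)" by (simp add: algebra_simps)
  moreover have "0 < q * (1 - q) * (t - s)" using assms by simp
  ultimately have "q * s * (q * t + (1 - q) * (1 - t)) < q * t * (q * s + (1 - q) * (1 - s))"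
    by linarith
  with D show ?thesis
    unfolding update_def by (simp only: divide_less_eq less_divide_eq times_divide_eq_left if_True not_less)
qed

text \<open>The signals \<open>s\<close> and \<open>1 - s\<close> have opposite log-likelihood
  ratios and cancel. This yields the message that a given signal carries exactly to a
  cutoff.\<close>

lemma update_reverse:
  assumes q: "q \<in> {0<..<1}" and s: "s \<in> {0<..<1}"
  shows "update (update q (1 - s)) s = q"
proof -
  let ?D = "q * (1 - s) + (1 - q) * s"
  have D: "?D > 0" using update_denominator_pos[of q "1 - s"] assms by simp
  have e: "update q (1 - s) = q * (1 - s) / ?D" by (simp add: update_def)
  have "1 - q * (1 - s) / ?D = (1 - q) * s / ?D" using D by (simp add: field_simps)
  then have "update (update q (1 - s)) s
      = (q * (s * (1 - s)) / ?D) / (q * (s * (1 - s)) / ?D + (1 - q) * (s * (1 - s)) / ?D)"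
    unfolding e by (subst update_def) (simp add: mult_ac)
  also have "\<dots> = (q * (s * (1 - s)) / ?D) / ((s * (1 - s)) / ?D)"
    by (simp add: add_divide_distrib[symmetric] algebra_simps)
  also have "\<dots> = q" using D s by simp
  finally show ?thesis .
qed

lemma update_interior:
  assumes q: "q \<in> {0<..<1}" and s: "s \<in> {0<..<1}"
  shows "update q s \<in> {0<..<1}"
proof -
  have "0 < q * s" "0 < (1 - q) * (1 - s)" using assms by auto
  then show ?thesis unfolding update_def by (auto simp: divide_less_eq_1 zero_less_divide_iff)
qed

section \<open>Signal distributions: quantiles, stochastic dominance and supports\<close>

text \<open>The point is a \<open>1 - c\<close> quantile of the law of the signal. The strict and
  the weak tail bracket \<open>c\<close>, which leaves room for an atom at \<open>t\<close> that can
  be split later to hit \<open>c\<close> exactly.\<close>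

lemma prob_quantile:
  fixes N :: "real measure"
  assumes "prob_space N" and [measurable]: "(\<lambda>s. s) \<in> borel_measurable N"
    and ae: "AE s in N. s \<in> {lo..hi}" and c: "0 < c" "c < 1"
  obtains t where "t \<in> {lo..hi}"
    "measure N {s \<in> space N. t < s} \<le> c" "c \<le> measure N {s \<in> space N. t \<le> s}"
proof -
  interpret N: prob_space N by fact
  let ?D = "distr N borel (\<lambda>s. s)"
  interpret D: real_distribution ?D by standard auto
  have le: "measure ?D {..t} = measure N {s \<in> space N. s \<le> t}" for t
    by (subst measure_distr) (auto intro!: arg_cong[where f = "measure N"])
  have less: "measure ?D {..<t} = measure N {s \<in> space N. s < t}" for t
    by (subst measure_distr) (auto intro!: arg_cong[where f = "measure N"])
  have hi: "cdf ?D hi = 1"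
    unfolding cdf_def le by (rule N.prob_eq_1[THEN iffD2]) (use ae in auto)
  have lo: "cdf ?D t = 0" if "t < lo" for t
    unfolding cdf_def le by (rule N.prob_eq_0[THEN iffD2]) (use ae that in auto)
  define T where "T = {t. 1 - c \<le> cdf ?D t}"
  have hiT: "hi \<in> T" using hi c by (simp add: T_def)
  have loT: "lo \<le> t" if "t \<in> T" for t
    using that lo[of t] c by (force simp: T_def)
  then have bdd: "bdd_below T" by (auto simp: bdd_below_def)
  define t where "t = Inf T"
  have t: "t \<in> {lo..hi}"
  proof -
    have "T \<noteq> {}" using hiT by auto
    then show ?thesis
      unfolding t_def using cInf_lower[OF hiT bdd] cInf_greatest[of T lo, OF _ loT] by simp
  qed
  have above: "1 - c \<le> cdf ?D y" if "t < y" for y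
  proof -
    have "T \<noteq> {}" using hiT by auto
    then obtain z where "z \<in> T" "z < y"
      using cInf_lessD[of T y] \<open>t < y\<close> unfolding t_def by metis
    then show ?thesis using D.cdf_nondecreasing[of z y] by (simp add: T_def)
  qed
  have below: "cdf ?D y \<le> 1 - c" if "y < t" for y
    using that cInf_lower[OF _ bdd, of y] unfolding t_def T_def by force
  \<comment> \<open>Right continuity of the distribution function bounds the mass up to and
    including \<open>t\<close>; its left limit bounds the mass strictly below
    \<open>t\<close>.\<close>
  have "1 - c \<le> cdf ?D t"
  proof (rule tendsto_lowerbound)
    show "(cdf ?D \<longlongrightarrow> cdf ?D t) (at_right t)"
      using D.cdf_is_right_cont[of t] by (simp add: continuous_within)
  qed (auto simp: eventually_at_right_field intro!: exI[of _ "t + 1"] above)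
  moreover have "measure ?D {..<t} \<le> 1 - c"
    by (rule tendsto_upperbound[OF D.cdf_at_left])
      (auto simp: eventually_at_left_field intro!: exI[of _ "t - 1"] below)
  moreover have "measure N {s \<in> space N. t < s} = 1 - measure N {s \<in> space N. s \<le> t}"
    by (subst N.prob_compl[symmetric]) (auto intro!: arg_cong[where f = "measure N"])
  moreover have "measure N {s \<in> space N. t \<le> s} = 1 - measure N {s \<in> space N. s < t}"
    by (subst N.prob_compl[symmetric]) (auto intro!: arg_cong[where f = "measure N"])
  ultimately show ?thesis
    by (intro that[OF t]) (simp_all add: cdf_def le less)
qed

lemma info_structureD:
  assumes "info_structure F"
  shows "prob_space (F \<omega>)" "sets (F \<omega>) = sets (F False)" "space (F \<omega>) = space (F False)"
    "(\<lambda>s. s) \<in> borel_measurable (F \<omega>)" "space (F \<omega>) \<subseteq> {0<..<1}"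
proof -
  have e: "sets (F \<omega>) = sets (F False)" for \<omega>
    using assms by (cases \<omega>) (auto simp: info_structure_def)
  show "prob_space (F \<omega>)" using assms by (cases \<omega>) (auto simp: info_structure_def)
  show "sets (F \<omega>) = sets (F False)" "space (F \<omega>) = space (F False)"
    using e sets_eq_imp_space_eq[OF e] by auto
  show "(\<lambda>s. s) \<in> borel_measurable (F \<omega>)" "space (F \<omega>) \<subseteq> {0<..<1}"
    unfolding measurable_cong_sets[OF e refl, of \<omega>] sets_eq_imp_space_eq[OF e, of \<omega>]
    using assms by (simp_all only: info_structure_def)
qed

lemma update_measurable:
  assumes "info_structure F"
  shows "(\<lambda>s. update m s) \<in> borel_measurable (F False)"
proof -
  have [measurable]: "(\<lambda>s. s) \<in> borel_measurable (F False)" using assms by (rule info_structureD)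
  show ?thesis unfolding update_def by measurable
qed

text \<open>First-order stochastic dominance: the likelihood ratio of the two states at signal
  \<open>s\<close> is \<open>s / (1 - s)\<close>, which is at least 1 above 1/2 and at most 1 below.
  Letting \<open>B\<close> range between the strict and the weak upper tail covers both at
  once.\<close>

lemma signal_tail_mono:
  assumes F: "info_structure F" and t: "t \<in> {0<..<1}"
    and [measurable]: "B \<in> sets (F False)"
    and B: "{s \<in> space (F False). t < s} \<subseteq> B" "B \<subseteq> {s \<in> space (F False). t \<le> s}"
  shows "measure (F False) B \<le> measure (F True) B"
proof -
  note D = info_structureD[OF F]
  have int: "set_integrable (F \<omega>) C (\<lambda>s. s)" if "C \<in> sets (F False)" for \<omega> C
  proof -
    interpret prob_space "F \<omega>" by (rule D)
    have [measurable]: "C \<in> sets (F \<omega>)" "(\<lambda>s. s) \<in> borel_measurable (F \<omega>)" using that D by auto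
    show ?thesis unfolding set_integrable_def
      using D(5)[of \<omega>] by (intro integrable_const_bound[where B = 1] AE_I2) (auto simp: indicator_def)
  qed
  have intc: "set_integrable (F \<omega>) C (\<lambda>s. t)" "(LINT s:C|F \<omega>. t) = t * measure (F \<omega>) C"
    if "C \<in> sets (F False)" for \<omega> C
  proof -
    interpret prob_space "F \<omega>" by (rule D)
    have [measurable]: "C \<in> sets (F \<omega>)" using that D by auto
    show "set_integrable (F \<omega>) C (\<lambda>s. t)" "(LINT s:C|F \<omega>. t) = t * measure (F \<omega>) C"
      by (auto simp: set_integrable_def set_lebesgue_integral_def integrable_indicator_iff less_top[symmetric])
  qed
  have bayes: "measure (F True) C = (LINT s:C|F False. s) + (LINT s:C|F True. s)"
    if "C \<in> sets (F False)" for C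
    using F that unfolding info_structure_def by force
  show ?thesis
  proof (cases "t \<ge> 1/2")
    case True
    \<comment> \<open>On \<open>B\<close> the posterior is at least \<open>t\<close>; inserting this
      in the Bayes identity compares the measures of \<open>B\<close> with odds
      \<open>t / (1 - t)\<close>, here at least 1.\<close>
    have "t * measure (F \<omega>) B \<le> (LINT s:B|F \<omega>. s)" for \<omega>
      unfolding intc(2)[OF \<open>B \<in> _\<close>, symmetric]
      by (rule set_integral_mono) (use B int intc in auto)
    from this[of False] this[of True]
    have "t * measure (F False) B \<le> (1 - t) * measure (F True) B"
      using bayes[of B] by (simp add: algebra_simps)
    moreover have "(1 - t) * measure (F False) B \<le> t * measure (F False) B"
      using True by (intro mult_right_mono) auto
    ultimately have "(1 - t) * measure (F False) B \<le> (1 - t) * measure (F True) B" by linarith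
    then show ?thesis using t by simp
  next
    case False
    \<comment> \<open>For \<open>t < 1/2\<close> the likelihood ratio on \<open>B\<close> may fall
      on both sides of 1, but on the complement it stays below 1, so the comparison is made there
      and then reversed.\<close>
    let ?C = "space (F False) - B"
    have C: "?C \<in> sets (F False)" by simp
    have "(LINT s:?C|F \<omega>. s) \<le> t * measure (F \<omega>) ?C" for \<omega>
      unfolding intc(2)[OF C, symmetric]
      by (rule set_integral_mono) (use B int[OF C] intc[OF C] in auto)
    from this[of False] this[of True]
    have "(1 - t) * measure (F True) ?C \<le> t * measure (F False) ?C"
      using bayes[OF C] by (simp add: algebra_simps)
    moreover have "t * measure (F False) ?C \<le> (1 - t) * measure (F False) ?C"
      using False by (intro mult_right_mono) auto
    ultimately have "(1 - t) * measure (F True) ?C \<le> (1 - t) * measure (F False) ?C" by linarith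
    then have "measure (F True) ?C \<le> measure (F False) ?C" using t by simp
    moreover have "measure (F \<omega>) ?C = 1 - measure (F \<omega>) B" for \<omega>
      using prob_space.prob_compl[OF D(1), of B \<omega>] D(2,3)[of \<omega>] by simp
    ultimately show ?thesis by simp
  qed
qed

text \<open>The complement of the support is covered by open null sets; by the Lindelof property
  countably many of them suffice, so it is null.\<close>

lemma AE_in_support:
  assumes [measurable]: "(\<lambda>s. s) \<in> borel_measurable N"
  shows "AE s in N. s \<in> support N"
proof -
  define \<U> where "\<U> = {U. open U \<and> emeasure N (U \<inter> space N) = 0}"
  obtain \<V> where V: "\<V> \<subseteq> \<U>" "countable \<V>" "\<Union>\<V> = \<Union>\<U>"
    using Lindelof[of \<U>] by (auto simp: \<U>_def)
  have sets: "U \<inter> space N \<in> sets N" if "open U" for U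
  proof -
    have "U \<in> sets borel" using that by simp
    then have "(\<lambda>s. s) -` U \<inter> space N \<in> sets N" using assms by (rule measurable_sets[rotated])
    then show ?thesis by simp
  qed
  have "(\<Union>U\<in>\<V>. U \<inter> space N) \<in> null_sets N"
    using V by (intro null_sets_UN') (auto simp: \<U>_def null_sets_def sets)
  moreover have "{s \<in> space N. s \<notin> support N} \<subseteq> (\<Union>U\<in>\<V>. U \<inter> space N)"
  proof
    fix s assume "s \<in> {s \<in> space N. s \<notin> support N}"
    then have "s \<in> \<Union>\<U>" "s \<in> space N" by (auto simp: support_def \<U>_def zero_less_iff_neq_zero)
    then show "s \<in> (\<Union>U\<in>\<V>. U \<inter> space N)" using V by auto
  qed
  ultimately show ?thesis by (rule AE_I')
qed

lemma near_uninformativeD: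
  assumes "F \<in> near_uninformative \<delta>"
  shows "info_structure F" "AE s in F \<omega>. \<bar>s - 1/2\<bar> \<le> \<delta>"
proof -
  show F: "info_structure F" using assms by (simp add: near_uninformative_def)
  have "AE s in F \<omega>. s \<in> support (F \<omega>)"
    by (rule AE_in_support) (rule info_structureD[OF F])
  moreover have "support (F \<omega>) \<subseteq> {1/2 - \<delta>..1/2 + \<delta>}"
    using assms by (simp add: near_uninformative_def)
  ultimately show "AE s in F \<omega>. \<bar>s - 1/2\<bar> \<le> \<delta>"
    by (elim eventually_mono) (auto simp: abs_le_iff subset_iff)
qed

lemma uninformative_near: "0 \<le> \<delta> \<Longrightarrow> uninformative \<in> near_uninformative \<delta>"
proof -
  assume \<delta>: "0 \<le> \<delta>"
  have "s \<notin> support (uninformative \<omega>)" if "s \<noteq> 1/2" for s \<omega>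
  proof -
    have "emeasure (uninformative \<omega>) ((- {1/2}) \<inter> space (uninformative \<omega>)) = 0"
      by (simp add: uninformative_def)
    then show ?thesis using that unfolding support_def
      by (auto intro!: exI[of _ "- {1/2}"])
  qed
  then have sub: "support (uninformative \<omega>) \<subseteq> {1/2}" for \<omega> by blast
  have "support (uninformative \<omega>) \<subseteq> {1/2 - \<delta>..1/2 + \<delta>}" for \<omega>
    by (rule subset_trans[OF sub]) (use \<delta> in simp)
  then show ?thesis by (simp add: near_uninformative_def info_structure_uninformative)
qed

text \<open>Serves both for the sender's mixing between two messages and for the receiver's
  tie-breaking between two actions.\<close>

definition two_point :: "real \<Rightarrow> 'b \<Rightarrow> 'b \<Rightarrow> 'b pmf" where
  "two_point c y z = map_pmf (\<lambda>b. if b then y else z) (bernoulli_pmf c)"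

lemma set_two_point: "set_pmf (two_point c y z) \<subseteq> {y, z}"
  by (auto simp: two_point_def)

lemma pmf_two_point:
  assumes "0 \<le> c" "c \<le> 1" "y \<noteq> z"
  shows "pmf (two_point c y z) y = c" "pmf (two_point c y z) z = 1 - c"
proof -
  have i: "inj (\<lambda>b. if b then y else z)" using assms by (auto simp: inj_def split: if_splits)
  show "pmf (two_point c y z) y = c" "pmf (two_point c y z) z = 1 - c"
    using pmf_map_inj'[OF i, of "bernoulli_pmf c" True] pmf_map_inj'[OF i, of "bernoulli_pmf c" False] assms
    by (auto simp: two_point_def)
qed

lemma expectation_two_point:
  assumes "0 \<le> c" "c \<le> 1"
  shows "measure_pmf.expectation (two_point c y z) f = c * f y + (1 - c) * (f z :: real)"
  using assms by (simp add: two_point_def)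

lemma eventually_at_right_0_less: "0 < c \<Longrightarrow> \<forall>\<^sub>F d in at_right 0. d < (c :: real)"
  by (rule eventually_at_right_real[THEN eventually_mono]) auto

text \<open>A discrete intermediate value argument, used to find two adjacent actions whose
  utilities lie on different sides of the target value.\<close>

lemma last_before_failure:
  fixes n k :: nat
  assumes "P n" "\<not> P k" "n \<le> k"
  obtains i where "n \<le> i" "i < k" "P i" "\<not> P (Suc i)"
proof -
  have "\<exists>i\<ge>n. i < k \<and> P i \<and> \<not> P (Suc i)"
    using assms(3,2)
  proof (induction k rule: dec_induct)
    case base
    then show ?case using assms(1) by simp
  next
    case (step k)
    then show ?case by (cases "P k") (auto intro: less_SucI)
  qed
  then show ?thesis using that by auto
qed

subsection \<open>Equilibria with few messages\<close>

text \<open>The interim utility as a function of the reply to one message only, so that replies can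
  be built and evaluated message by message before a receiver strategy is assembled.\<close>

definition payoff ::
    "('a \<Rightarrow> real) \<Rightarrow> (bool \<Rightarrow> real measure) \<Rightarrow> (real \<Rightarrow> 'a pmf) \<Rightarrow> bool \<Rightarrow> real" where
  "payoff uS F r \<omega> = (LINT s|F \<omega>. mixed_utility uS (r s))"

lemma interim_utility_eq_payoff: "interim_utility uS F \<rho> \<omega> m = payoff uS F (\<rho> m) \<omega>"
  by (simp add: interim_utility_def payoff_def)

definition best_response ::
    "'a set \<Rightarrow> ('a \<Rightarrow> bool \<Rightarrow> real) \<Rightarrow> (bool \<Rightarrow> real measure) \<Rightarrow> real \<Rightarrow> (real \<Rightarrow> 'a pmf) \<Rightarrow> bool" where
  "best_response A uR F m r \<longleftrightarrow>
     (\<forall>s\<in>space (F False). set_pmf (r s) \<subseteq> best_replies A uR (update m s)) \<and>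
     (\<forall>b\<in>A. (\<lambda>s. pmf (r s) b) \<in> borel_measurable (F False))"

lemma best_replies_subset: "best_replies A uR q \<subseteq> A"
  by (auto simp: best_replies_def)

lemma equilibrium_best_response:
  assumes "cheap_talk_equilibrium A uR uS F \<pi> M \<sigma> \<rho>" "m \<in> M"
  shows "best_response A uR F m (\<rho> m)"
  using assms by (auto simp: cheap_talk_equilibrium_def receiver_strategy_def best_response_def)

text \<open>Posteriors average to the prior, so some sent message lies weakly on each side of it.
  Incentive compatibility gives all messages sent in state \<open>\<omega>\<close> the same interim
  utility \<open>W \<omega>\<close>; a message with posterior above 0 is sent in state
  \<open>True\<close>, one with posterior below 1 in state \<open>False\<close>.\<close>

lemma equilibrium_messages:
  assumes eq: "cheap_talk_equilibrium A uR uS F \<pi> M \<sigma> \<rho>" and \<pi>: "0 < \<pi>" "\<pi> < 1"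
  obtains W m m' where "m \<in> M" "m' \<in> M" "0 \<le> m" "m \<le> \<pi>" "\<pi> \<le> m'" "m' \<le> 1"
    "\<And>\<omega>. payoff uS F (\<rho> m) \<omega> \<le> W \<omega>" "\<And>\<omega>. payoff uS F (\<rho> m') \<omega> \<le> W \<omega>"
    "payoff uS F (\<rho> m) False = W False" "payoff uS F (\<rho> m') True = W True"
    "0 < m \<Longrightarrow> payoff uS F (\<rho> m) True = W True"
    "m' < 1 \<Longrightarrow> payoff uS F (\<rho> m') False = W False"
    "ex_ante_utility uS F \<pi> M \<sigma> \<rho> = (1 - \<pi>) * W False + \<pi> * W True"
proof -
  let ?w = "\<lambda>\<omega> m. payoff uS F (\<rho> m) \<omega>"
  let ?mp = "message_prob \<pi> \<sigma>"
  have fin: "finite M" and M: "M \<subseteq> {0..1}" and sub: "\<And>\<omega>. set_pmf (\<sigma> \<omega>) \<subseteq> M"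
    and bayes: "\<And>m. m \<in> M \<Longrightarrow> ?mp m > 0 \<Longrightarrow> \<pi> * pmf (\<sigma> True) m / ?mp m = m"
    and ic: "\<And>m m' \<omega>. m \<in> M \<Longrightarrow> m' \<in> M \<Longrightarrow> pmf (\<sigma> \<omega>) m > 0 \<Longrightarrow> ?mp m' > 0 \<Longrightarrow> ?w \<omega> m' \<le> ?w \<omega> m"
    using eq by (auto simp: cheap_talk_equilibrium_def sender_strategy_def interim_utility_eq_payoff)
  have mp: "?mp m = \<pi> * pmf (\<sigma> True) m + (1 - \<pi>) * pmf (\<sigma> False) m" for m
    by (simp add: message_prob_def UNIV_bool weight_def)
  have mp0: "0 \<le> ?mp m" for m using \<pi> by (simp add: mp)
  have sent: "?mp m > 0" if "pmf (\<sigma> \<omega>) m > 0" for \<omega> m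
    using that \<pi> by (cases \<omega>) (auto simp: mp intro: add_pos_nonneg add_nonneg_pos)
  \<comment> \<open>Bayes' rule without division; for a message that is never sent both sides
    vanish.\<close>
  have T: "\<pi> * pmf (\<sigma> True) m = m * ?mp m" if "m \<in> M" for m
  proof (cases "?mp m > 0")
    case True
    with bayes[OF that] show ?thesis by (simp add: field_simps)
  next
    case False
    then have "?mp m = 0" using mp0[of m] by simp
    moreover from this have "\<pi> * pmf (\<sigma> True) m = 0"
      using \<pi> by (simp add: mp add_nonneg_eq_0_iff)
    ultimately show ?thesis by simp
  qed
  then have F: "(1 - \<pi>) * pmf (\<sigma> False) m = (1 - m) * ?mp m" if "m \<in> M" for m
    using T[OF that] mp[of m] by (simp add: left_diff_distrib)
  have sum1: "(\<Sum>m\<in>M. pmf (\<sigma> \<omega>) m) = 1" for \<omega> using fin sub by (rule sum_pmf_eq_1)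
  have summp: "(\<Sum>m\<in>M. ?mp m) = 1"
    by (simp add: mp sum.distrib sum_distrib_left[symmetric] sum1)
  have "(\<Sum>m\<in>M. m * ?mp m) = (\<Sum>m\<in>M. \<pi> * pmf (\<sigma> True) m)"
    by (intro sum.cong) (auto simp: T)
  then have mean: "(\<Sum>m\<in>M. m * ?mp m) = \<pi>" by (simp add: sum_distrib_left[symmetric] sum1)
  have dev: "(\<Sum>m\<in>M. (m - \<pi>) * ?mp m) = 0"
    by (simp add: left_diff_distrib sum_subtractf mean sum_distrib_left[symmetric] summp)
  \<comment> \<open>Otherwise all terms of \<open>dev\<close> are nonnegative, hence zero, and no
    message carries any mass.\<close>
  have "\<exists>m\<in>M. ?mp m > 0 \<and> m \<le> \<pi>"
  proof (rule ccontr)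
    assume H: "\<not> ?thesis"
    then have "0 \<le> (m - \<pi>) * ?mp m" if "m \<in> M" for m
      using that mp0[of m] by (cases "?mp m = 0") (force intro: mult_nonneg_nonneg)+
    then have "\<forall>m\<in>M. (m - \<pi>) * ?mp m = 0" using dev fin by (simp add: sum_nonneg_eq_0_iff)
    then have "?mp m = 0" if "m \<in> M" for m using that H mp0[of m] by force
    then show False using summp by simp
  qed
  then obtain m where m: "m \<in> M" "?mp m > 0" "m \<le> \<pi>" by blast
  have "\<exists>m\<in>M. ?mp m > 0 \<and> \<pi> \<le> m"
  proof (rule ccontr)
    assume H: "\<not> ?thesis"
    then have "0 \<le> (\<pi> - m) * ?mp m" if "m \<in> M" for m
      using that mp0[of m] by (cases "?mp m = 0") (force intro: mult_nonneg_nonneg)+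
    moreover have "(\<Sum>m\<in>M. (\<pi> - m) * ?mp m) = 0"
      using dev by (simp add: left_diff_distrib sum_subtractf)
    ultimately have "\<forall>m\<in>M. (\<pi> - m) * ?mp m = 0" using fin by (simp add: sum_nonneg_eq_0_iff)
    then have "?mp m = 0" if "m \<in> M" for m using that H mp0[of m] by force
    then show False using summp by simp
  qed
  then obtain m' where m': "m' \<in> M" "?mp m' > 0" "\<pi> \<le> m'" by blast
  have "\<exists>n. n \<in> M \<and> pmf (\<sigma> \<omega>) n > 0" for \<omega>
    using sub[of \<omega>] set_pmf_not_empty[of "\<sigma> \<omega>"] by (auto simp: pmf_positive_iff)
  then obtain n where n: "\<And>\<omega>. n \<omega> \<in> M" "\<And>\<omega>. pmf (\<sigma> \<omega>) (n \<omega>) > 0" by metis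
  \<comment> \<open>Any message sent in state \<open>\<omega>\<close> may serve as reference: it
    weakly beats every sent message and ties with all those sent in \<open>\<omega>\<close>.\<close>
  define W where "W = (\<lambda>\<omega>. ?w \<omega> (n \<omega>))"
  have le: "?w \<omega> m \<le> W \<omega>" if "m \<in> M" "?mp m > 0" for \<omega> m
    unfolding W_def using that n by (intro ic)
  have W: "?w \<omega> m = W \<omega>" if "m \<in> M" "pmf (\<sigma> \<omega>) m > 0" for \<omega> m
    using le[OF that(1) sent[OF that(2)]] ic[of m "n \<omega>" \<omega>] that n sent[of \<omega> "n \<omega>"]
    by (intro antisym) (auto simp: W_def)
  have posF: "pmf (\<sigma> False) k > 0" if "k \<in> M" "?mp k > 0" "k < 1" for k
  proof -
    have "0 < (1 - \<pi>) * pmf (\<sigma> False) k" unfolding F[OF that(1)] using that by simp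
    then show ?thesis using \<pi> by (simp add: zero_less_mult_iff)
  qed
  have posT: "pmf (\<sigma> True) k > 0" if "k \<in> M" "?mp k > 0" "0 < k" for k
  proof -
    have "0 < \<pi> * pmf (\<sigma> True) k" unfolding T[OF that(1)] using that by simp
    then show ?thesis using \<pi> by (simp add: zero_less_mult_iff)
  qed
  have "(\<Sum>m\<in>M. pmf (\<sigma> \<omega>) m * ?w \<omega> m) = W \<omega>" for \<omega>
  proof -
    have "(\<Sum>m\<in>M. pmf (\<sigma> \<omega>) m * ?w \<omega> m) = (\<Sum>m\<in>M. pmf (\<sigma> \<omega>) m * W \<omega>)"
      using W by (intro sum.cong) (auto simp: less_le)
    then show ?thesis by (simp add: sum_distrib_right[symmetric] sum1)
  qed
  then have ex: "ex_ante_utility uS F \<pi> M \<sigma> \<rho> = (1 - \<pi>) * W False + \<pi> * W True"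
    by (simp add: ex_ante_utility_def UNIV_bool weight_def interim_utility_eq_payoff)
  show ?thesis
    by (rule that[OF m(1) m'(1) _ m(3) m'(3) _ le[OF m(1,2)] le[OF m'(1,2)] _ _ _ _ ex])
      (use m m' M \<pi> in \<open>auto intro!: W posF posT\<close>)
qed

lemma babbling_equilibrium:
  assumes r: "best_response A uR F \<pi> r" and \<pi>: "0 < \<pi>" "\<pi> < 1"
  shows "\<exists>M \<sigma> \<rho>. cheap_talk_equilibrium A uR uS F \<pi> M \<sigma> \<rho> \<and>
    ex_ante_utility uS F \<pi> M \<sigma> \<rho> = (1 - \<pi>) * payoff uS F r False + \<pi> * payoff uS F r True"
proof (intro exI conjI)
  show "cheap_talk_equilibrium A uR uS F \<pi> {\<pi>} (\<lambda>_. return_pmf \<pi>) (\<lambda>_. r)"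
    using r \<pi> best_replies_subset[of A uR]
    by (fastforce simp: cheap_talk_equilibrium_def sender_strategy_def receiver_strategy_def
        best_response_def message_prob_def UNIV_bool weight_def)
  show "ex_ante_utility uS F \<pi> {\<pi>} (\<lambda>_. return_pmf \<pi>) (\<lambda>_. r)
      = (1 - \<pi>) * payoff uS F r False + \<pi> * payoff uS F r True"
    by (simp add: ex_ante_utility_def UNIV_bool weight_def interim_utility_eq_payoff)
qed

text \<open>The prior is split between \<open>m\<close> and \<open>m'\<close>. The last two
  incentive conditions are conditional because \<open>m = 0\<close> is never sent in state
  \<open>True\<close> and \<open>m' = 1\<close> never in state \<open>False\<close>: a state need
  not be indifferent to a message that it does not send.\<close>

lemma two_message_equilibrium:
  assumes r: "best_response A uR F m r" and r': "best_response A uR F m' r'"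
    and \<pi>: "0 < \<pi>" "\<pi> < 1" and m: "0 \<le> m" "m < \<pi>" "\<pi> < m'" "m' \<le> 1"
    and ic: "payoff uS F r' False \<le> payoff uS F r False"
      "payoff uS F r True \<le> payoff uS F r' True"
      "0 < m \<Longrightarrow> payoff uS F r' True \<le> payoff uS F r True"
      "m' < 1 \<Longrightarrow> payoff uS F r False \<le> payoff uS F r' False"
  shows "\<exists>M \<sigma> \<rho>. cheap_talk_equilibrium A uR uS F \<pi> M \<sigma> \<rho> \<and>
    ex_ante_utility uS F \<pi> M \<sigma> \<rho> = (1 - \<pi>) * payoff uS F r False + \<pi> * payoff uS F r' True"
proof -
  \<comment> \<open>\<open>p\<close> is the total probability of \<open>m\<close> that makes the
    posteriors average to the prior; \<open>c \<omega>\<close> is the probability of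
    \<open>m\<close> in state \<open>\<omega>\<close> that Bayes' rule then dictates.\<close>
  define p where "p = (m' - \<pi>) / (m' - m)"
  define c where "c \<omega> = (if \<omega> then m * p / \<pi> else (1 - m) * p / (1 - \<pi>))" for \<omega>
  define \<sigma> where "\<sigma> \<omega> = two_point (c \<omega>) m m'" for \<omega>
  define \<rho> where "\<rho> n = (if n = m then r else r')" for n
  have ne: "m \<noteq> m'" using m by simp
  have p: "0 < p" "p < 1" using m by (auto simp: p_def divide_simps)
  have pm: "m * p + m' * (1 - p) = \<pi>" 
  proof -
    have "p * (m' - m) = m' - \<pi>" using m by (simp add: p_def)
    then show ?thesis by (simp add: algebra_simps)
  qed
  have "m * p \<le> \<pi> * 1" using p m \<pi> by (intro mult_mono) auto
  moreover have "(1 - m) * p \<le> 1 - \<pi>"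
  proof -
    have "0 \<le> (1 - m') * (1 - p)" using m p by simp
    moreover have "(1 - m) * p + (1 - m') * (1 - p) = 1 - \<pi>"
      using pm by (simp add: algebra_simps)
    ultimately show ?thesis by linarith
  qed
  ultimately have c: "0 \<le> c \<omega>" "c \<omega> \<le> 1" for \<omega>
    using \<pi> m p by (auto simp: c_def)
  have pmf: "pmf (\<sigma> \<omega>) m = c \<omega>" "pmf (\<sigma> \<omega>) m' = 1 - c \<omega>" for \<omega>
    using pmf_two_point[OF c ne] by (auto simp: \<sigma>_def)
  have cT: "\<pi> * c True = m * p" and cF: "(1 - \<pi>) * c False = (1 - m) * p"
    using \<pi> by (auto simp: c_def)
  have mp: "message_prob \<pi> \<sigma> m = p" "message_prob \<pi> \<sigma> m' = 1 - p"
    using cT cF by (simp_all add: message_prob_def UNIV_bool weight_def pmf algebra_simps)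
  have "m' * (1 - p) = \<pi> * (1 - c True)" using pm cT by (simp add: algebra_simps)
  then have sender: "sender_strategy \<pi> {m, m'} \<sigma>"
    using m \<pi> p cT set_two_point[of _ m m']
    by (auto simp: sender_strategy_def mp pmf \<sigma>_def[symmetric] field_simps)
      (auto simp: \<sigma>_def)
  have cm: "c True = 0" if "m = 0" using that by (simp add: c_def)
  have cm': "c False = 1" if "m' = 1"
    using that m \<pi> by (simp add: c_def p_def)
  have pos: "0 < m" if "pmf (\<sigma> True) m > 0"
    using that cm m unfolding pmf by (cases "m = 0") auto
  have pos': "m' < 1" if "pmf (\<sigma> False) m' > 0"
    using that cm' m unfolding pmf by (cases "m' = 1") auto
  have ic': "payoff uS F (\<rho> n') \<omega> \<le> payoff uS F (\<rho> n) \<omega>"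
    if "n \<in> {m, m'}" "n' \<in> {m, m'}" "pmf (\<sigma> \<omega>) n > 0" for n n' \<omega>
    using that ic(1,2) ic(3)[OF pos] ic(4)[OF pos'] ne by (cases \<omega>) (auto simp: \<rho>_def)
  have "cheap_talk_equilibrium A uR uS F \<pi> {m, m'} \<sigma> \<rho>"
    unfolding cheap_talk_equilibrium_def interim_utility_eq_payoff
  proof (intro conjI)
    show "receiver_strategy A F {m, m'} \<rho>"
      using r r' best_replies_subset[of A uR]
      by (fastforce simp: receiver_strategy_def best_response_def \<rho>_def)
    show "\<forall>n\<in>{m, m'}. \<forall>s\<in>space (F False). set_pmf (\<rho> n s) \<subseteq> best_replies A uR (update n s)"
      using r r' by (auto simp: best_response_def \<rho>_def)
  qed (use sender ic' in blast)+
  moreover have "ex_ante_utility uS F \<pi> {m, m'} \<sigma> \<rho>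
      = (1 - \<pi>) * payoff uS F r False + \<pi> * payoff uS F r' True"
  proof -
    \<comment> \<open>Either \<open>m'\<close> reveals state \<open>True\<close> and has probability
      0 here, or the two incentive conditions of this state combine to an equality.\<close>
    have "c False * payoff uS F r False + (1 - c False) * payoff uS F r' False = payoff uS F r False"
      using ic m cm' by (cases "m' = 1") (auto simp: algebra_simps)
    moreover have "c True * payoff uS F r True + (1 - c True) * payoff uS F r' True = payoff uS F r' True"
      using ic m cm by (cases "m = 0") (auto simp: algebra_simps)
    ultimately show ?thesis
      using ne by (simp add: ex_ante_utility_def UNIV_bool weight_def interim_utility_eq_payoff pmf \<rho>_def)
  qed
  ultimately show ?thesis by blast
qed

section \<open>Bounds and measurability of payoffs\<close>

lemma mixed_utility_le:
  assumes "set_pmf \<alpha> \<subseteq> C" "finite C" "\<And>b. b \<in> C \<Longrightarrow> uS b \<le> c"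
  shows "mixed_utility uS \<alpha> \<le> c"
proof (rule measure_pmf.integral_le_const)
  show "integrable (measure_pmf \<alpha>) uS"
    using assms(1,2) by (intro integrable_measure_pmf_finite) (rule finite_subset)
qed (use assms in \<open>auto simp: AE_measure_pmf_iff\<close>)

lemma mixed_utility_abs_le:
  assumes "set_pmf \<alpha> \<subseteq> C" "finite C" "\<And>b. b \<in> C \<Longrightarrow> \<bar>uS b\<bar> \<le> c"
  shows "\<bar>mixed_utility uS \<alpha>\<bar> \<le> c"
proof -
  have "mixed_utility uS \<alpha> \<le> c"
    using assms by (intro mixed_utility_le[of _ C]) (auto simp: abs_le_iff)
  moreover have "mixed_utility (\<lambda>b. - uS b) \<alpha> \<le> c"
    using assms by (intro mixed_utility_le[of _ C]) (auto simp: abs_le_iff)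
  ultimately show ?thesis by (simp add: abs_le_iff)
qed

lemma mixed_utility_singleton: "set_pmf \<alpha> \<subseteq> {b} \<Longrightarrow> mixed_utility uS \<alpha> = uS b"
  by (simp add: set_pmf_subset_singleton)

lemma mixed_utility_measurable:
  assumes F: "info_structure F" and r: "best_response A uR F m r" and A: "finite A"
  shows "(\<lambda>s. mixed_utility uS (r s)) \<in> borel_measurable (F \<omega>)"
proof -
  have sub: "set_pmf (r s) \<subseteq> A" if "s \<in> space (F False)" for s
    using r that best_replies_subset[of A uR] unfolding best_response_def by blast
  have "(\<lambda>s. mixed_utility uS (r s)) \<in> borel_measurable (F False)
      \<longleftrightarrow> (\<lambda>s. \<Sum>b\<in>A. uS b * pmf (r s) b) \<in> borel_measurable (F False)"
    by (rule measurable_cong, rule integral_measure_pmf_real) (use A sub in auto)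
  also have "\<dots>"
    using r by (intro borel_measurable_sum borel_measurable_times) (auto simp: best_response_def)
  finally show ?thesis
    using measurable_cong_sets[OF info_structureD(2)[OF F] refl] by blast
qed

lemma payoff_abs_le:
  assumes F: "info_structure F" and r: "best_response A uR F m r" and A: "finite A"
    and c: "\<And>b. b \<in> A \<Longrightarrow> \<bar>uS b\<bar> \<le> c"
  shows "\<bar>payoff uS F r \<omega>\<bar> \<le> c"
proof -
  interpret prob_space "F \<omega>" using F by (rule info_structureD)
  have b: "\<bar>mixed_utility uS (r s)\<bar> \<le> c" if "s \<in> space (F \<omega>)" for s
  proof (rule mixed_utility_abs_le[OF _ A c])
    have "s \<in> space (F False)" using that info_structureD(3)[OF F, of \<omega>] by simp
    then have "set_pmf (r s) \<subseteq> best_replies A uR (update m s)"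
      using r by (simp add: best_response_def)
    then show "set_pmf (r s) \<subseteq> A" using best_replies_subset by (rule subset_trans)
  qed
  have int: "integrable (F \<omega>) (\<lambda>s. mixed_utility uS (r s))"
    using b mixed_utility_measurable[OF F r A] by (intro integrable_const_bound[of _ c]) auto
  have "payoff uS F r \<omega> \<le> c" "- c \<le> payoff uS F r \<omega>"
    unfolding payoff_def
    by (intro integral_le_const integral_ge_const int AE_I2; drule b; linarith)+
  then show ?thesis by (simp add: abs_le_iff)
qed

lemma payoff_eq_AE:
  assumes "info_structure F" "best_response A uR F m r" "finite A"
    and "f \<in> borel_measurable (F \<omega>)" "AE s in F \<omega>. mixed_utility uS (r s) = f s"
  shows "payoff uS F r \<omega> = (LINT s|F \<omega>. f s)"
  unfolding payoff_def
  by (rule integral_cong_AE[OF mixed_utility_measurable[OF assms(1-3)] assms(4,5)])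

lemma payoff_uninformative: "payoff uS uninformative r \<omega> = mixed_utility uS (r (1/2))"
  by (simp add: payoff_def uninformative_def integral_return)

subsection \<open>Binary signals\<close>

text \<open>Signal \<open>s\<close> has probability \<open>s\<close> in state \<open>True\<close>
  and \<open>1 - s\<close> in state \<open>False\<close>, so from prior 1/2 both signals are equally
  likely and each is its own posterior.\<close>

definition binary_structure :: "real \<Rightarrow> bool \<Rightarrow> real measure" where
  "binary_structure d \<omega> = point_measure {1/2 - d, 1/2 + d} (\<lambda>s. ennreal (weight s \<omega>))"

lemma sets_binary_structure: "sets (binary_structure d \<omega>) = Pow {1/2 - d, 1/2 + d}"
  and space_binary_structure: "space (binary_structure d \<omega>) = {1/2 - d, 1/2 + d}"
  by (simp_all add: binary_structure_def sets_point_measure space_point_measure)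

lemma integral_binary_structure:
  assumes "0 < d" "d < 1/2"
  shows "(LINT s|binary_structure d \<omega>. f s)
    = weight (1/2 - d) \<omega> * f (1/2 - d) + weight (1/2 + d) \<omega> * (f (1/2 + d) :: real)"
  unfolding binary_structure_def using assms
  by (subst lebesgue_integral_point_measure_finite) (auto simp: weight_def)

lemma emeasure_binary_structure:
  assumes "0 < d" "d < 1/2" "B \<subseteq> {1/2 - d, 1/2 + d}"
  shows "emeasure (binary_structure d \<omega>) B = ennreal (\<Sum>s\<in>B. weight s \<omega>)"
proof -
  have "finite B" using assms(3) by (rule finite_subset) simp
  have "0 \<le> weight s \<omega>" if "s \<in> B" for s using that assms by (auto simp: weight_def)
  then show ?thesis unfolding binary_structure_def using assms
    by (subst emeasure_point_measure_finite) (auto simp: sum_ennreal)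
qed

lemma measure_binary_structure:
  assumes "0 < d" "d < 1/2" "B \<subseteq> {1/2 - d, 1/2 + d}"
  shows "measure (binary_structure d \<omega>) B = (\<Sum>s\<in>B. weight s \<omega>)"
proof -
  have "0 \<le> weight s \<omega>" if "s \<in> B" for s using that assms by (auto simp: weight_def)
  then show ?thesis
    by (intro measure_eq_emeasure_eq_ennreal emeasure_binary_structure assms sum_nonneg)
qed

lemma binary_structure_info:
  assumes d: "0 < d" "d < 1/2"
  shows "info_structure (binary_structure d)"
proof -
  let ?S = "{1/2 - d, 1/2 + d}"
  \<comment> \<open>Both signals have positive weight in both states, so only the empty set is null
    and mutual absolute continuity is immediate.\<close>
  have null: "B = {}" if "B \<subseteq> ?S" "emeasure (binary_structure d \<omega>) B = 0" for B \<omega>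
  proof -
    have fin: "finite B" using that(1) by (rule finite_subset) simp
    have pos: "0 < weight s \<omega>" if "s \<in> B" for s using that \<open>B \<subseteq> ?S\<close> d by (auto simp: weight_def)
    have "(\<Sum>s\<in>B. weight s \<omega>) \<le> 0"
      using that by (simp add: emeasure_binary_structure[OF d] ennreal_eq_0_iff)
    then show ?thesis using sum_pos[OF fin _ pos] by fastforce
  qed
  then have ac: "absolutely_continuous (binary_structure d \<omega>) (binary_structure d \<omega>')" for \<omega> \<omega>'
    unfolding absolutely_continuous_def null_sets_def sets_binary_structure by auto
  have prob: "prob_space (binary_structure d \<omega>)" for \<omega>
  proof (rule prob_spaceI)
    have "(\<Sum>s\<in>?S. weight s \<omega>) = 1" using d by (simp add: weight_def)
    then show "emeasure (binary_structure d \<omega>) (space (binary_structure d \<omega>)) = 1"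
      unfolding space_binary_structure emeasure_binary_structure[OF d subset_refl] by (simp only: ennreal_1)
  qed
  have bayes: "measure (binary_structure d True) B
      = (LINT s:B|binary_structure d False. s) + (LINT s:B|binary_structure d True. s)"
    if B: "B \<subseteq> ?S" for B
  proof -
    have "(\<Sum>s\<in>B. s) = (\<Sum>s\<in>?S. if s \<in> B then s else 0)"
      by (rule sum.mono_neutral_cong_left) (use B in auto)
    also have "\<dots> = (if 1/2 - d \<in> B then 1/2 - d else 0) + (if 1/2 + d \<in> B then 1/2 + d else 0)"
      using d by simp
    finally show ?thesis
      unfolding set_lebesgue_integral_def integral_binary_structure[OF d] measure_binary_structure[OF d B]
      by (simp add: weight_def indicator_def field_simps)
  qed
  have "(\<lambda>s. s) \<in> borel_measurable (binary_structure d False)"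
    unfolding binary_structure_def by (simp add: measurable_point_measure_eq1)
  moreover have "?S \<subseteq> {0<..<1}" using d by auto
  ultimately show ?thesis
    unfolding info_structure_def
    using prob ac bayes by (simp add: sets_binary_structure space_binary_structure)
qed

lemma binary_structure_near:
  assumes d: "0 < d" "d < 1/2" "d \<le> \<delta>"
  shows "binary_structure d \<in> near_uninformative \<delta>"
proof -
  have "support (binary_structure d \<omega>) \<subseteq> {1/2 - \<delta>..1/2 + \<delta>}" for \<omega>
  proof (rule ccontr)
    assume "\<not> ?thesis"
    then obtain s where s: "s \<in> support (binary_structure d \<omega>)" "s \<in> - {1/2 - \<delta>..1/2 + \<delta>}"
      by (auto simp only: subset_eq Ball_def Compl_iff)
    have "open (- {1/2 - \<delta>..1/2 + \<delta>})" by (intro open_Compl closed_atLeastAtMost)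
    then have "0 < emeasure (binary_structure d \<omega>) (- {1/2 - \<delta>..1/2 + \<delta>} \<inter> {1/2 - d, 1/2 + d})"
      using s by (simp only: support_def space_binary_structure mem_Collect_eq)
    moreover have "- {1/2 - \<delta>..1/2 + \<delta>} \<inter> {1/2 - d, 1/2 + d} = {}" using d by auto
    ultimately show False by simp
  qed
  then show ?thesis using binary_structure_info d by (simp add: near_uninformative_def)
qed

subsection \<open>The receiver's best replies\<close>

locale cheap_talk_game =
  fixes A :: "'a set" and a :: "nat \<Rightarrow> 'a" and l :: nat and x :: "nat \<Rightarrow> real"
    and uR :: "'a \<Rightarrow> bool \<Rightarrow> real" and uS :: "'a \<Rightarrow> real"
  assumes actions: "bij_betw a {1..l} A"
    and cutoffs: "x 0 = 0" "x l = 1" "strict_mono_on {0..l} x"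
    and optimal: "\<And>i. i \<in> {1..l} \<Longrightarrow> {q \<in> {0..1}. a i \<in> best_replies A uR q} = {x (i - 1)..x i}"
    and generic: "inj_on uS A"
begin

abbreviation u :: "nat \<Rightarrow> real" where "u k \<equiv> uS (a k)"

lemma l_pos: "1 \<le> l"
  using cutoffs by (cases l) auto

lemma cutoff_less: "i < k \<Longrightarrow> k \<le> l \<Longrightarrow> x i < x k"
  using strict_mono_onD[OF cutoffs(3), of i k] by simp

lemma cutoff_less_iff: "i \<le> l \<Longrightarrow> k \<le> l \<Longrightarrow> x i < x k \<longleftrightarrow> i < k"
  using cutoff_less[of i k] cutoff_less[of k i] by (cases i k rule: linorder_cases) auto

lemma cutoff_le_iff: "i \<le> l \<Longrightarrow> k \<le> l \<Longrightarrow> x i \<le> x k \<longleftrightarrow> i \<le> k"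
  using cutoff_less_iff[of k i] by (simp add: not_less[symmetric])

lemma cutoff_bounds: "k \<le> l \<Longrightarrow> 0 \<le> x k" "k \<le> l \<Longrightarrow> x k \<le> 1"
  using cutoff_le_iff[of 0 k] cutoff_le_iff[of k l] cutoffs by auto

lemma finite_A: "finite A"
  using bij_betw_finite[OF actions] by simp

lemma u_eq_iff: "i \<in> {1..l} \<Longrightarrow> k \<in> {1..l} \<Longrightarrow> u i = u k \<longleftrightarrow> i = k"
  using actions generic by (metis bij_betw_apply bij_betw_imp_inj_on inj_on_eq_iff)

lemma best_replies_iff:
  assumes "q \<in> {0..1}" "k \<in> {1..l}"
  shows "a k \<in> best_replies A uR q \<longleftrightarrow> x (k - 1) \<le> q \<and> q \<le> x k"
  using optimal[OF assms(2)] assms(1) by (auto simp: set_eq_iff)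

lemma best_replies_index:
  assumes "b \<in> best_replies A uR q" "q \<in> {0..1}"
  obtains k where "k \<in> {1..l}" "b = a k" "x (k - 1) \<le> q" "q \<le> x k"
proof -
  have "b \<in> A" using best_replies_subset assms(1) by (rule subsetD)
  then obtain k where "k \<in> {1..l}" "b = a k" using actions by (auto simp: bij_betw_def)
  then show ?thesis using best_replies_iff[OF assms(2), of k] assms(1) that by simp
qed

lemma interval_unique:
  assumes "k \<in> {1..l}" "x (k - 1) < q" "q < x k" "i \<in> {1..l}" "x (i - 1) \<le> q" "q \<le> x i"
  shows "i = k"
proof -
  have "x (i - 1) < x k" "x (k - 1) < x i" using assms by linarith+
  moreover have "i - 1 \<le> l" "k - 1 \<le> l" "i \<le> l" "k \<le> l" using assms by auto
  ultimately have "i - 1 < k" "k - 1 < i" by (auto simp: cutoff_less_iff)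
  then show ?thesis using assms by auto
qed

lemma best_replies_interior:
  assumes k: "k \<in> {1..l}" and q: "x (k - 1) < q" "q < x k"
  shows "best_replies A uR q = {a k}"
proof -
  have "x 0 \<le> x (k - 1)" "x k \<le> x l" using k cutoff_le_iff[of 0 "k - 1"] cutoff_le_iff[of k l] by auto
  then have q': "q \<in> {0..1}" using q cutoffs by auto
  have "b = a k" if "b \<in> best_replies A uR q" for b
    using best_replies_index[OF that q'] interval_unique[OF k q] by metis
  moreover have "a k \<in> best_replies A uR q" using best_replies_iff[OF q' k] q by simp
  ultimately show ?thesis by blast
qed

text \<open>Unlike an inner cutoff, \<open>x 0\<close> bounds only one interval, so there is no tie
  at certainty. The same holds at the other end.\<close>

lemma best_replies_0: "best_replies A uR 0 = {a 1}"
proof -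
  have "b = a 1" if b: "b \<in> best_replies A uR 0" for b
  proof -
    obtain k where k: "k \<in> {1..l}" "b = a k" "x (k - 1) \<le> 0"
      using best_replies_index[OF b] by auto
    then have "k - 1 \<le> 0" using cutoff_le_iff[of "k - 1" 0] cutoffs(1) by auto
    then show ?thesis using k by (metis atLeastAtMost_iff diff_is_0_eq le_zero_eq nle_le)
  qed
  moreover have "a 1 \<in> best_replies A uR 0"
    using best_replies_iff[of 0 1] cutoff_less[of 0 1] cutoffs l_pos by auto
  ultimately show ?thesis by blast
qed

lemma best_replies_1: "best_replies A uR 1 = {a l}"
proof -
  have "b = a l" if b: "b \<in> best_replies A uR 1" for b
  proof -
    obtain k where k: "k \<in> {1..l}" "b = a k" "1 \<le> x k"
      using best_replies_index[OF b] by auto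
    then have "l \<le> k" using cutoff_le_iff[of l k] cutoffs(2) by auto
    then show ?thesis using k by auto
  qed
  moreover have "a l \<in> best_replies A uR 1"
    using best_replies_iff[of 1 l] cutoff_less[of "l - 1" l] cutoffs l_pos by auto
  ultimately show ?thesis by blast
qed

text \<open>A measurable selection of best replies, resolving ties at inner cutoffs in favour of the
  lower action. The constraint \<open>1 \<le> k\<close> matters at belief 0, where index 0 would
  otherwise be selected.\<close>

definition reply :: "real \<Rightarrow> 'a" where
  "reply q = a (LEAST k. 1 \<le> k \<and> q \<le> x k)"

lemma reply_best:
  assumes q: "q \<in> {0..1}"
  shows "reply q \<in> best_replies A uR q"
proof -
  let ?P = "\<lambda>k. 1 \<le> k \<and> q \<le> x k"
  define k where "k = (LEAST k. ?P k)"
  have Pl: "?P l" using q cutoffs l_pos by simp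
  have k: "?P k" unfolding k_def by (rule LeastI[of ?P, OF Pl])
  have kl: "k \<le> l" unfolding k_def by (rule Least_le[of ?P, OF Pl])
  have "x (k - 1) \<le> q"
  proof (cases "k = 1")
    case True
    then show ?thesis using q cutoffs by simp
  next
    case False
    then have "k - 1 < k" using k by simp
    then have "\<not> ?P (k - 1)" unfolding k_def by (rule not_less_Least)
    then show ?thesis using False k by auto
  qed
  then show ?thesis
    unfolding reply_def k_def[symmetric] using best_replies_iff[OF q, of k] k kl by simp
qed

lemma reply_measurable:
  assumes [measurable]: "f \<in> borel_measurable N"
  shows "(\<lambda>s. pmf (return_pmf (reply (f s))) b) \<in> borel_measurable N"
proof -
  have [measurable]: "(\<lambda>s. LEAST k. 1 \<le> k \<and> f s \<le> x k) \<in> measurable N (count_space UNIV)"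
    by measurable
  have "(\<lambda>s. if a (LEAST k. 1 \<le> k \<and> f s \<le> x k) = b then 1 else 0 :: real) \<in> borel_measurable N"
    by measurable
  then show ?thesis by (simp add: reply_def pmf_return indicator_def if_distrib eq_commute cong: if_cong)
qed

lemma best_response_reply:
  assumes F: "info_structure F" and m: "m \<in> {0..1}"
  shows "best_response A uR F m (\<lambda>s. return_pmf (reply (update m s)))"
  unfolding best_response_def
  using reply_measurable[OF update_measurable[OF F]] info_structureD(5)[OF F, of False] m
  by (auto intro!: reply_best update_bounds[of m, simplified])

text \<open>Only the reply to the single signal \<open>t\<close> is altered, which preserves
  measurability; \<open>t\<close> will be the signal that carries the message to a cutoff, where
  mixing is optimal.\<close>

lemma best_response_mixed_reply:
  assumes F: "info_structure F" and m: "m \<in> {0..1}"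
    and \<alpha>: "set_pmf \<alpha> \<subseteq> best_replies A uR (update m t)"
  shows "best_response A uR F m (\<lambda>s. if s = t then \<alpha> else return_pmf (reply (update m s)))"
proof -
  have [measurable]: "(\<lambda>s. s) \<in> borel_measurable (F False)" using F by (rule info_structureD)
  have "(\<lambda>s. if s = t then pmf \<alpha> b else pmf (return_pmf (reply (update m s))) b)
      \<in> borel_measurable (F False)" for b
    using reply_measurable[OF update_measurable[OF F], of m b] by measurable
  moreover have "(\<lambda>s. pmf (if s = t then \<alpha> else return_pmf (reply (update m s))) b) =
      (\<lambda>s. if s = t then pmf \<alpha> b else pmf (return_pmf (reply (update m s))) b)" for b
    by auto
  ultimately show ?thesis
    using best_response_reply[OF F m] \<alpha> by (auto simp: best_response_def)
qed

section \<open>Uniform bounds on equilibrium values\<close>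

definition utility_bound :: real where
  "utility_bound = Max ((\<lambda>b. \<bar>uS b\<bar>) ` A)"

lemma utility_bound: "b \<in> A \<Longrightarrow> \<bar>uS b\<bar> \<le> utility_bound"
  unfolding utility_bound_def using finite_A by (intro Max_ge) auto

lemma ex_ante_abs_le:
  assumes F: "info_structure F" and \<pi>: "0 < \<pi>" "\<pi> < 1"
    and eq: "cheap_talk_equilibrium A uR uS F \<pi> M \<sigma> \<rho>"
  shows "\<bar>ex_ante_utility uS F \<pi> M \<sigma> \<rho>\<bar> \<le> utility_bound"
proof -
  obtain W m m' where m: "m \<in> M" "m' \<in> M" and W: "payoff uS F (\<rho> m) False = W False"
    "payoff uS F (\<rho> m') True = W True"
    and ex: "ex_ante_utility uS F \<pi> M \<sigma> \<rho> = (1 - \<pi>) * W False + \<pi> * W True"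
    by (rule equilibrium_messages[OF eq \<pi>]) blast
  have "\<bar>W False\<bar> \<le> utility_bound" "\<bar>W True\<bar> \<le> utility_bound"
    unfolding W[symmetric]
    by (rule payoff_abs_le[OF F equilibrium_best_response[OF eq] finite_A utility_bound], use m in auto)+
  then have "\<bar>(1 - \<pi>) * W False\<bar> + \<bar>\<pi> * W True\<bar> \<le> (1 - \<pi>) * utility_bound + \<pi> * utility_bound"
    using \<pi> by (intro add_mono) (auto simp: abs_mult intro!: mult_left_mono)
  then show ?thesis unfolding ex by (simp add: algebra_simps)
qed

lemma equilibrium_value_ge:
  assumes F: "info_structure F" and \<pi>: "0 < \<pi>" "\<pi> < 1"
    and eq: "\<exists>M \<sigma> \<rho>. cheap_talk_equilibrium A uR uS F \<pi> M \<sigma> \<rho> \<and> ex_ante_utility uS F \<pi> M \<sigma> \<rho> = c"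
  shows "c \<le> equilibrium_value A uR uS F \<pi>"
  unfolding equilibrium_value_def
proof (rule cSup_upper)
  show "bdd_above {ex_ante_utility uS F \<pi> M \<sigma> \<rho> |M \<sigma> \<rho>. cheap_talk_equilibrium A uR uS F \<pi> M \<sigma> \<rho>}"
    using ex_ante_abs_le[OF F \<pi>] by (intro bdd_aboveI[of _ utility_bound]) (force simp: abs_le_iff)
qed (use eq in blast)

lemma equilibrium_exists:
  assumes F: "info_structure F" and \<pi>: "0 < \<pi>" "\<pi> < 1"
  obtains M \<sigma> \<rho> where "cheap_talk_equilibrium A uR uS F \<pi> M \<sigma> \<rho>"
  using babbling_equilibrium[OF best_response_reply[OF F] \<pi>] \<pi> by force

lemma equilibrium_value_le:
  assumes F: "info_structure F" and \<pi>: "0 < \<pi>" "\<pi> < 1"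
    and le: "\<And>M \<sigma> \<rho>. cheap_talk_equilibrium A uR uS F \<pi> M \<sigma> \<rho> \<Longrightarrow> ex_ante_utility uS F \<pi> M \<sigma> \<rho> \<le> c"
  shows "equilibrium_value A uR uS F \<pi> \<le> c"
  unfolding equilibrium_value_def
proof (rule cSup_least)
  show "{ex_ante_utility uS F \<pi> M \<sigma> \<rho> |M \<sigma> \<rho>. cheap_talk_equilibrium A uR uS F \<pi> M \<sigma> \<rho>} \<noteq> {}"
    using equilibrium_exists[OF F \<pi>] by (metis (mono_tags, lifting) empty_iff mem_Collect_eq)
qed (use le in auto)

lemma equilibrium_value_lower_bound:
  assumes F: "info_structure F" and \<pi>: "0 < \<pi>" "\<pi> < 1"
  shows "- utility_bound \<le> equilibrium_value A uR uS F \<pi>"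
proof -
  obtain M \<sigma> \<rho> where eq: "cheap_talk_equilibrium A uR uS F \<pi> M \<sigma> \<rho>"
    using equilibrium_exists[OF F \<pi>] by blast
  have "ex_ante_utility uS F \<pi> M \<sigma> \<rho> \<le> equilibrium_value A uR uS F \<pi>"
    using eq by (intro equilibrium_value_ge[OF F \<pi>]) blast
  then show ?thesis using ex_ante_abs_le[OF F \<pi> eq] by linarith
qed

section \<open>Payoffs of messages inside an interval, at an extreme belief and near a
  cutoff\<close>

lemma payoff_constant:
  assumes F: "info_structure F" and r: "best_response A uR F m r"
    and "AE s in F \<omega>. best_replies A uR (update m s) = {a i}"
  shows "payoff uS F r \<omega> = u i"
proof -
  interpret prob_space "F \<omega>" using F by (rule info_structureD)
  have "AE s in F \<omega>. mixed_utility uS (r s) = u i"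
    using assms(3) AE_space
  proof eventually_elim
    case (elim s)
    then show ?case
      using r info_structureD(3)[OF F, of \<omega>] by (intro mixed_utility_singleton) (auto simp: best_response_def)
  qed
  then have "payoff uS F r \<omega> = (LINT s|F \<omega>. u i)"
    by (intro payoff_eq_AE[OF F r finite_A]) auto
  then show ?thesis by (simp add: prob_space)
qed

text \<open>Almost every signal moves the belief by at most \<open>2 * \<delta>\<close>, so the
  receiver never leaves the interior of the interval.\<close>

lemma payoff_near_interior:
  assumes F: "F \<in> near_uninformative \<delta>" and \<delta>: "\<delta> \<le> 1/4" and i: "i \<in> {1..l}"
    and m: "x (i - 1) + 2 * \<delta> < m" "m + 2 * \<delta> < x i" "m \<in> {0..1}"
    and r: "best_response A uR F m r"
  shows "payoff uS F r \<omega> = u i"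
proof (rule payoff_constant[OF near_uninformativeD(1)[OF F] r])
  show "AE s in F \<omega>. best_replies A uR (update m s) = {a i}"
    using near_uninformativeD(2)[OF F]
  proof eventually_elim
    case (elim s)
    then have "\<bar>update m s - m\<bar> \<le> 2 * \<delta>" using m(3) \<delta> by (intro update_near)
    then show ?case using m(1,2) by (intro best_replies_interior[OF i]) linarith+
  qed
qed

text \<open>No signal moves a degenerate belief, so a revealing message is worth the same in both
  states under every information structure.\<close>

lemma payoff_0:
  assumes F: "info_structure F" and r: "best_response A uR F 0 r"
  shows "payoff uS F r \<omega> = u 1"
  by (rule payoff_constant[OF F r]) (simp add: best_replies_0)

lemma payoff_1:
  assumes F: "info_structure F" and r: "best_response A uR F 1 r"
  shows "payoff uS F r \<omega> = u l"
proof (rule payoff_constant[OF F r])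
  have "best_replies A uR (update 1 s) = {a l}" if "s \<in> space (F \<omega>)" for s
    using that info_structureD(5)[OF F, of \<omega>] by (subst update_extreme) (auto simp: best_replies_1)
  then show "AE s in F \<omega>. best_replies A uR (update 1 s) = {a l}" by (rule AE_I2)
qed

text \<open>
  The message is chosen such that signal \<open>t\<close>, a quantile of \<open>F \<omega>\<close>, moves it exactly to the
  cutoff; monotonicity of the signal tails then compares the two states.
\<close>

lemma payoff_near_cutoff:
  assumes F: "F \<in> near_uninformative \<delta>" and \<delta>: "0 \<le> \<delta>" "\<delta> \<le> 1/8"
    and k: "1 \<le> k" "k < l" and gap: "x (k - 1) + 4 * \<delta> < x k" "x k + 4 * \<delta> < x (Suc k)"
    and p: "0 < (p - u k) * (u (Suc k) - p)"
  obtains m r where "m \<in> {0<..<1}" "\<bar>m - x k\<bar> \<le> 2 * \<delta>" "best_response A uR F m r"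
    "payoff uS F r \<omega> = p"
    "0 \<le> (u (Suc k) - u k) * (payoff uS F r True - payoff uS F r False)"
proof -
  note I = near_uninformativeD(1)[OF F]
  have xk: "x k \<in> {0<..<1}" using k cutoff_less[of 0 k] cutoff_less[of k l] cutoffs by auto
  \<comment> \<open>\<open>D\<close> may have either sign. The hypothesis on \<open>p\<close> says
    that it lies strictly between the two utilities, so the weight \<open>c\<close> of action
    \<open>a (Suc k)\<close> that produces \<open>p\<close> lies strictly between 0 and 1.\<close>
  define D where "D = u (Suc k) - u k"
  define c where "c = (p - u k) / D"
  have "0 < c \<and> c < 1 \<and> D \<noteq> 0"
    using p unfolding c_def D_def by (auto simp: zero_less_mult_iff zero_less_divide_iff divide_less_eq)
  then have c: "0 < c" "c < 1" and D: "D \<noteq> 0" by auto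
  have sets: "{s \<in> space (F \<omega>). t < s} \<in> sets (F \<omega>)" "{s \<in> space (F \<omega>). t \<le> s} \<in> sets (F \<omega>)" for t \<omega>
  proof -
    have [measurable]: "(\<lambda>s. s) \<in> borel_measurable (F \<omega>)" using I by (rule info_structureD)
    show "{s \<in> space (F \<omega>). t < s} \<in> sets (F \<omega>)" "{s \<in> space (F \<omega>). t \<le> s} \<in> sets (F \<omega>)"
      by measurable
  qed
  define P where "P \<omega> t = measure (F \<omega>) {s \<in> space (F \<omega>). t < s}" for \<omega> t
  define Q where "Q \<omega> t = measure (F \<omega>) {s \<in> space (F \<omega>). t \<le> s}" for \<omega> t
  have "AE s in F \<omega>. s \<in> {1/2 - \<delta>..1/2 + \<delta>}"
    using near_uninformativeD(2)[OF F, of \<omega>] by eventually_elim (auto simp: abs_le_iff)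
  then obtain t where t: "t \<in> {1/2 - \<delta>..1/2 + \<delta>}" and PQ: "P \<omega> t \<le> c" "c \<le> Q \<omega> t"
    using prob_quantile[OF info_structureD(1)[OF I, of \<omega>] info_structureD(4)[OF I, of \<omega>],
        of "1/2 - \<delta>" "1/2 + \<delta>" c] c
    unfolding P_def Q_def by blast
  have t01: "t \<in> {0<..<1}" using t \<delta> by auto
  \<comment> \<open>The probability of the upper action at signal \<open>t\<close>. It splits the
    atom there so that the upper action has total probability \<open>c\<close>; without an atom both
    tails already equal \<open>c\<close>.\<close>
  define \<theta> where "\<theta> = (if Q \<omega> t = P \<omega> t then 0 else (c - P \<omega> t) / (Q \<omega> t - P \<omega> t))"
  have \<theta>: "0 \<le> \<theta>" "\<theta> \<le> 1" "(1 - \<theta>) * P \<omega> t + \<theta> * Q \<omega> t = c"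
  proof -
    show "0 \<le> \<theta>" "\<theta> \<le> 1" using PQ by (auto simp: \<theta>_def divide_le_eq_1)
    have "\<theta> * (Q \<omega> t - P \<omega> t) = c - P \<omega> t" using PQ by (auto simp: \<theta>_def)
    then show "(1 - \<theta>) * P \<omega> t + \<theta> * Q \<omega> t = c" by (simp add: algebra_simps)
  qed
  have mono: "P False t \<le> P True t" "Q False t \<le> Q True t"
    unfolding P_def Q_def info_structureD(3)[OF I, of True]
    by (rule signal_tail_mono[OF I t01 sets(1)]; auto)
      (rule signal_tail_mono[OF I t01 sets(2)]; auto)
  define m where "m = update (x k) (1 - t)"
  have m: "m \<in> {0<..<1}" unfolding m_def using xk t01 by (intro update_interior) auto
  have mx: "\<bar>m - x k\<bar> \<le> 2 * \<delta>"
    unfolding m_def using xk t \<delta> by (intro update_near) (auto simp: abs_le_iff)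
  have mt: "update m t = x k" unfolding m_def using xk t01 by (rule update_reverse)
  define \<alpha> where "\<alpha> = two_point \<theta> (a (Suc k)) (a k)"
  have \<alpha>: "set_pmf \<alpha> \<subseteq> best_replies A uR (update m t)"
    using set_two_point[of \<theta> "a (Suc k)" "a k"] best_replies_iff[of "x k" k] best_replies_iff[of "x k" "Suc k"]
      xk k cutoff_less[of k "Suc k"] cutoff_less[of "k - 1" k]
    unfolding \<alpha>_def mt by fastforce
  define r where "r s = (if s = t then \<alpha> else return_pmf (reply (update m s)))" for s
  have r: "best_response A uR F m r"
    unfolding r_def using best_response_mixed_reply[OF I _ \<alpha>] m by auto
  \<comment> \<open>The message is within \<open>2 * \<delta>\<close> of the cutoff and moves by at
    most as much again, so only the two adjacent intervals are reached; the signal lies above or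
    below \<open>t\<close> according to which one.\<close>
  have val: "mixed_utility uS (r s) = u k + D * ((1 - \<theta>) * indicator {t<..} s + \<theta> * indicator {t..} s)"
    if s: "s \<in> {0<..<1}" "\<bar>s - 1/2\<bar> \<le> \<delta>" for s
  proof -
    have "\<bar>update m s - m\<bar> \<le> 2 * \<delta>"
      using m s \<delta> by (intro update_near) auto
    then have near: "x (k - 1) < update m s" "update m s < x (Suc k)" using mx gap by linarith+
    have bounds: "update m s \<in> {0..1}" using m s by (intro update_bounds) auto
    consider "s < t" | "s = t" | "t < s" by linarith
    then show ?thesis
    proof cases
      case 1
      then have "update m s < x k" using update_strict_mono[OF m s(1) t01] mt by simp
      then have "best_replies A uR (update m s) = {a k}" using near k by (intro best_replies_interior) auto
      then have "reply (update m s) = a k" using reply_best[OF bounds] by simp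
      then show ?thesis using 1 by (simp add: r_def)
    next
      case 2
      then show ?thesis using \<theta> by (simp add: r_def \<alpha>_def expectation_two_point D_def algebra_simps)
    next
      case 3
      then have "x k < update m s" using update_strict_mono[OF m t01 s(1)] mt by simp
      then have "best_replies A uR (update m s) = {a (Suc k)}" using near k by (intro best_replies_interior) auto
      then have "reply (update m s) = a (Suc k)" using reply_best[OF bounds] by simp
      then show ?thesis using 3 by (simp add: r_def D_def algebra_simps)
    qed
  qed
  have pay: "payoff uS F r \<omega> = u k + D * ((1 - \<theta>) * P \<omega> t + \<theta> * Q \<omega> t)" for \<omega>
  proof -
    interpret prob_space "F \<omega>" using I by (rule info_structureD)
    let ?f = "\<lambda>s. u k + D * ((1 - \<theta>) * indicator {s \<in> space (F \<omega>). t < s} s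
      + \<theta> * indicator {s \<in> space (F \<omega>). t \<le> s} s)"
    note [measurable] = sets[of \<omega> t]
    have "AE s in F \<omega>. mixed_utility uS (r s) = ?f s"
      using near_uninformativeD(2)[OF F, of \<omega>] AE_space
    proof eventually_elim
      case (elim s)
      then show ?case using val[of s] info_structureD(5)[OF I, of \<omega>] by (auto simp: indicator_def)
    qed
    then have "payoff uS F r \<omega> = (LINT s|F \<omega>. ?f s)"
      by (intro payoff_eq_AE[OF I r finite_A]) auto
    also have "\<dots> = u k + D * ((1 - \<theta>) * P \<omega> t + \<theta> * Q \<omega> t)"
      by (simp add: prob_space P_def Q_def less_top[symmetric] integrable_indicator_iff)
    finally show ?thesis .
  qed
  have "payoff uS F r \<omega> = p" unfolding pay \<theta>(3) using D by (simp add: c_def)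
  moreover have "0 \<le> D * (payoff uS F r True - payoff uS F r False)"
  proof -
    have "(1 - \<theta>) * P False t + \<theta> * Q False t \<le> (1 - \<theta>) * P True t + \<theta> * Q True t"
      using \<theta> mono by (intro add_mono mult_left_mono) auto
    \<comment> \<open>One factor \<open>D\<close> comes from the payoff formula and one from the
      claim, so the sign of \<open>D\<close> cancels.\<close>
    then have "0 \<le> D * D * (((1 - \<theta>) * P True t + \<theta> * Q True t) - ((1 - \<theta>) * P False t + \<theta> * Q False t))"
      by (intro mult_nonneg_nonneg[OF zero_le_square]) simp
    then show ?thesis unfolding pay by (simp add: algebra_simps)
  qed
  ultimately show ?thesis by (intro that[OF m mx r]) (simp_all only: D_def)
qed

end

subsection \<open>The value at a given prior\<close>

locale cheap_talk_prior = cheap_talk_game A a l x uR uS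
  for A :: "'a set" and a l x uR uS +
  fixes j :: nat and \<pi> :: real
  assumes j: "j \<in> {1..l}" and prior: "x (j - 1) < \<pi>" "\<pi> < x j"
begin

lemma prior_bounds: "0 < \<pi>" "\<pi> < 1"
proof -
  have "j - 1 \<le> l" "j \<le> l" using j by auto
  then show "0 < \<pi>" "\<pi> < 1" using prior cutoff_bounds(1)[of "j - 1"] cutoff_bounds(2)[of j] by linarith+
qed

text \<open>As the prior is inside the \<open>j\<close>-th interval, beliefs up to it meet exactly
  the first \<open>j\<close> intervals, so this is the maximum of \<open>v\<close> to the left of
  the prior. Likewise for \<open>right_value\<close>.\<close>

definition left_value :: real where "left_value = Max (u ` {1..j})"
definition right_value :: real where "right_value = Max (u ` {j..l})"
definition V :: real where "V = min left_value right_value"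

lemma u_le_left: "k \<in> {1..j} \<Longrightarrow> u k \<le> left_value"
  unfolding left_value_def by (intro Max_ge) auto

lemma u_le_right: "k \<in> {j..l} \<Longrightarrow> u k \<le> right_value"
  unfolding right_value_def by (intro Max_ge) auto

lemma left_value_attained: obtains i where "i \<in> {1..j}" "left_value = u i"
proof -
  have "left_value \<in> u ` {1..j}" unfolding left_value_def using j by (intro Max_in) auto
  then show ?thesis using that by auto
qed

lemma right_value_attained: obtains i where "i \<in> {j..l}" "right_value = u i"
proof -
  have "right_value \<in> u ` {j..l}" unfolding right_value_def using j by (intro Max_in) auto
  then show ?thesis using that by auto
qed

text \<open>If \<open>V\<close> is not \<open>u j\<close>, it exceeds \<open>u j\<close> and is
  attained on the side with the smaller maximum. On the other side utilities pass from below
  \<open>V\<close> at \<open>j\<close> to at least \<open>V\<close>, hence cross it between adjacent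
  actions; genericity makes the crossing strict.\<close>

lemma V_cases:
  obtains (trivial) "V = u j"
  | (left) i k where "i \<in> {1..<j}" "V = u i" "k \<in> {j..<l}" "u k < V" "V < u (Suc k)"
  | (right) i k where "i \<in> {j<..l}" "V = u i" "k \<in> {1..<j}" "V < u k" "u (Suc k) < V"
proof (cases "V = u j")
  case True
  then show ?thesis by (rule trivial)
next
  case False
  obtain i where i: "i \<in> {1..j}" "left_value = u i" by (rule left_value_attained)
  obtain i' where i': "i' \<in> {j..l}" "right_value = u i'" by (rule right_value_attained)
  have jV: "u j < V"
    using False u_le_left[of j] u_le_right[of j] j by (auto simp: V_def)
  have ne: "u n \<noteq> V" if "n \<in> {1..l}" "V = u n'" "n' \<in> {1..l}" "n \<noteq> n'" for n n'
    using u_eq_iff[OF that(1,3)] that by simp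
  show ?thesis
  proof (cases "left_value \<le> right_value")
    case True
    then have V: "V = u i" using i by (simp add: V_def)
    then have ij: "i \<in> {1..<j}" using i False by (cases "i = j") auto
    have "V \<le> u i'" using True i' i V by simp
    then obtain k where k: "j \<le> k" "k < i'" "u k < V" "\<not> u (Suc k) < V"
      using last_before_failure[of "\<lambda>k. u k < V" j i'] jV i' by (auto simp: not_less)
    moreover have "u (Suc k) \<noteq> V" using ij j i' k by (intro ne[OF _ V]) auto
    ultimately show ?thesis using i' by (intro left[OF ij V, of k]) auto
  next
    case False
    then have V: "V = u i'" using i' by (simp add: V_def)
    then have ij: "i' \<in> {j<..l}" using i' \<open>V \<noteq> u j\<close> by (cases "i' = j") auto
    have "\<not> u i < V" using False i' i V by simp
    then obtain k where k: "i \<le> k" "k < j" "\<not> u k < V" "u (Suc k) < V"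
      using last_before_failure[of "\<lambda>k. \<not> u k < V" i j] jV i by auto
    moreover have "u k \<noteq> V" using ij j i k by (intro ne[OF _ V]) auto
    ultimately show ?thesis using i by (intro right[OF ij V, of k]) auto
  qed
qed

section \<open>Lower bounds valid for all weak signals\<close>

text \<open>The factor 4 allows for a message \<open>2 * \<delta>\<close> away from a cutoff that
  signals move by another \<open>2 * \<delta>\<close>; the factor 2 keeps the updated prior in its
  interval and messages near other cutoffs on their side of the prior.\<close>

definition small :: "real \<Rightarrow> bool" where
  "small \<delta> \<longleftrightarrow> 0 < \<delta> \<and> \<delta> \<le> 1/8 \<and> (\<forall>k\<in>{1..l}. x (k - 1) + 4 * \<delta> < x k) \<and>
     x (j - 1) + 2 * \<delta> < \<pi> \<and> \<pi> + 2 * \<delta> < x j"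

lemma eventually_small: "\<forall>\<^sub>F \<delta> in at_right 0. small \<delta>"
proof -
  have "\<forall>\<^sub>F \<delta> in at_right 0. x (k - 1) + 4 * \<delta> < x k" if "k \<in> {1..l}" for k
    using eventually_at_right_0_less[of "(x k - x (k - 1)) / 4"] cutoff_less[of "k - 1" k] that
    by (auto elim!: eventually_mono)
  then have "\<forall>\<^sub>F \<delta> in at_right 0. \<forall>k\<in>{1..l}. x (k - 1) + 4 * \<delta> < x k"
    by (intro eventually_ball_finite) auto
  moreover have "\<forall>\<^sub>F \<delta> in at_right 0. (0::real) < \<delta>" by (rule eventually_at_right_less)
  moreover have "\<forall>\<^sub>F \<delta> in at_right 0. \<delta> < (1/8 :: real)" by (rule eventually_at_right_0_less) simp
  moreover have "\<forall>\<^sub>F \<delta> in at_right 0. \<delta> < (\<pi> - x (j - 1)) / 2" by (rule eventually_at_right_0_less) (use prior in simp)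
  moreover have "\<forall>\<^sub>F \<delta> in at_right 0. \<delta> < (x j - \<pi>) / 2" by (rule eventually_at_right_0_less) (use prior in simp)
  ultimately show ?thesis
    unfolding small_def by eventually_elim auto
qed

lemma babbling_value:
  assumes small: "small \<delta>" and F: "F \<in> near_uninformative \<delta>"
  shows "u j \<le> equilibrium_value A uR uS F \<pi>"
proof -
  note I = near_uninformativeD(1)[OF F]
  have r: "best_response A uR F \<pi> (\<lambda>s. return_pmf (reply (update \<pi> s)))"
    using prior_bounds by (intro best_response_reply[OF I]) auto
  have pay: "payoff uS F (\<lambda>s. return_pmf (reply (update \<pi> s))) \<omega> = u j" for \<omega>
    using prior_bounds small unfolding small_def
    by (intro payoff_near_interior[OF F _ j _ _ _ r]) auto
  have "(1 - \<pi>) * u j + \<pi> * u j \<le> equilibrium_value A uR uS F \<pi>"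
    using equilibrium_value_ge[OF I prior_bounds babbling_equilibrium[OF r prior_bounds, of uS]]
    unfolding pay .
  then show ?thesis by (simp add: algebra_simps)
qed

text \<open>An inner action is induced by the midpoint of its interval, out of reach of the cutoffs.
  For an extreme action the revealing belief is taken instead, so that the message is absent in one
  state.\<close>

lemma constant_message:
  assumes small: "small \<delta>" and F: "F \<in> near_uninformative \<delta>" and i: "i \<in> {1..l}"
  obtains m r where "x (i - 1) \<le> m" "m \<le> x i" "best_response A uR F m r" "\<And>\<omega>. payoff uS F r \<omega> = u i"
    "i = 1 \<Longrightarrow> m = 0" "i = l \<Longrightarrow> i \<noteq> 1 \<Longrightarrow> m = 1"
proof -
  note I = near_uninformativeD(1)[OF F]
  define m where "m = (if i = 1 then 0 else if i = l then 1 else (x (i - 1) + x i) / 2)"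
  have lt: "x (i - 1) < x i" "0 \<le> x (i - 1)" "x i \<le> 1"
    using i cutoff_less[of "i - 1" i] cutoff_le_iff[of 0 "i - 1"] cutoff_le_iff[of i l] cutoffs by auto
  then have m: "x (i - 1) \<le> m" "m \<le> x i" using cutoffs by (auto simp: m_def)
  let ?r = "\<lambda>s. return_pmf (reply (update m s))"
  have r: "best_response A uR F m ?r"
    using m lt by (intro best_response_reply[OF I]) auto
  have "payoff uS F ?r \<omega> = u i" for \<omega>
  proof -
    consider "i = 1" | "i \<noteq> 1" "i = l" | "i \<noteq> 1" "i \<noteq> l" by blast
    then show ?thesis
    proof cases
      case 1
      then have "m = 0" by (simp add: m_def)
      then show ?thesis using payoff_0[OF I, of ?r] r 1 by simp
    next
      case 2
      then have "m = 1" by (simp add: m_def)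
      then show ?thesis using payoff_1[OF I, of ?r] r 2 by simp
    next
      case 3
      have "x (i - 1) + 4 * \<delta> < x i" "\<delta> \<le> 1/8" using small i by (auto simp: small_def)
      moreover have "m = (x (i - 1) + x i) / 2" using 3 by (simp add: m_def)
      ultimately show ?thesis
        using m lt by (intro payoff_near_interior[OF F _ i _ _ _ r]) auto
    qed
  qed
  then show ?thesis using m r by (intro that[of m ?r]) (auto simp: m_def)
qed

text \<open>
  If signals are informative, the message near a cutoff may be strictly better in one state; the
  other message is then sent in the opposite state only, so it reveals that state and its utility
  is that of an extreme action.
\<close>

lemma equilibrium_value_ge_V:
  assumes small: "small \<delta>" and F: "F \<in> near_uninformative \<delta>"
    and safe: "F = uninformative \<or> V = u j \<or> (\<exists>i\<in>{1, l}. V = u i)"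
  shows "V \<le> equilibrium_value A uR uS F \<pi>"
proof -
  note I = near_uninformativeD(1)[OF F]
  note \<pi> = prior_bounds
  have d: "0 \<le> \<delta>" "\<delta> \<le> 1/8" and gap: "\<And>k. k \<in> {1..l} \<Longrightarrow> x (k - 1) + 4 * \<delta> < x k"
    and pg: "x (j - 1) + 2 * \<delta> < \<pi>" "\<pi> + 2 * \<delta> < x j"
    using small by (auto simp: small_def)
  have l1: "1 \<in> {1..l}" "l \<in> {1..l}" using l_pos by auto
  show ?thesis
  proof (cases rule: V_cases)
    case trivial
    then show ?thesis using babbling_value[OF small F] by simp
  next
    case (left i k)
    have i: "i \<in> {1..l}" "i \<noteq> l" "i \<noteq> j" using left(1) j by auto
    \<comment> \<open>By genericity only action \<open>a i\<close> has utility \<open>V\<close>, so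
      if it is inner, the first alternative of \<open>safe\<close> is the one that holds.\<close>
    have un: "F = uninformative" if "i \<noteq> 1"
      using safe left(2) u_eq_iff[OF i(1) j] u_eq_iff[OF i(1) l1(1)] u_eq_iff[OF i(1) l1(2)] i that by auto
    obtain m r where m: "x (i - 1) \<le> m" "m \<le> x i" "best_response A uR F m r"
      "\<And>\<omega>. payoff uS F r \<omega> = u i" "i = 1 \<Longrightarrow> m = 0"
      using constant_message[OF small F i(1)] by metis
    have k: "1 \<le> k" "k < l" using left(3) j by auto
    have V': "0 < (V - u k) * (u (Suc k) - V)" using left(4,5) by simp
    \<comment> \<open>Calibrated in state \<open>False\<close>, the one in which \<open>m\<close> is
      sent even if it is revealing. Utility rises across this cutoff, so dominance makes
      \<open>m'\<close> weakly better in state \<open>True\<close>.\<close>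
    obtain m' r' where m': "m' \<in> {0<..<1}" "\<bar>m' - x k\<bar> \<le> 2 * \<delta>" "best_response A uR F m' r'"
      "payoff uS F r' False = V"
      "0 \<le> (u (Suc k) - u k) * (payoff uS F r' True - payoff uS F r' False)"
      using payoff_near_cutoff[OF F d k _ _ V', of False] gap[of k] gap[of "Suc k"] k by auto
    have ge: "V \<le> payoff uS F r' True"
      using m'(4,5) left(4,5) by (simp add: zero_le_mult_iff)
    have "x i \<le> x (j - 1)" "x j \<le> x k" "0 \<le> x (i - 1)"
      using left(1,3) j cutoff_le_iff[of i "j - 1"] cutoff_le_iff[of j k] cutoff_le_iff[of 0 "i - 1"] cutoffs(1)
      by auto
    then have mm: "0 \<le> m" "m < \<pi>" "\<pi> < m'" using m m' prior pg by (auto simp: abs_le_iff)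
    have "(1 - \<pi>) * payoff uS F r False + \<pi> * payoff uS F r' True \<le> equilibrium_value A uR uS F \<pi>"
    proof (rule equilibrium_value_ge[OF I \<pi> two_message_equilibrium[OF m(3) m'(3) \<pi> mm]])
      assume "0 < m"
      then have "F = uninformative" using un m(5) by force
      then have "payoff uS F r' True = payoff uS F r' False" by (simp add: payoff_uninformative)
      then show "payoff uS F r' True \<le> payoff uS F r True" using m(4) m'(4) left(2) by simp
    qed (use m m' ge left(2) in auto)
    moreover have "(1 - \<pi>) * V + \<pi> * V \<le> (1 - \<pi>) * payoff uS F r False + \<pi> * payoff uS F r' True"
      using m(4) left(2) ge \<pi> by (intro add_mono mult_left_mono) auto
    ultimately show ?thesis by (simp add: algebra_simps)
  next
    case (right i k)
    have i: "i \<in> {1..l}" "i \<noteq> 1" "i \<noteq> j" using right(1) j by auto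
    have un: "F = uninformative" if "i \<noteq> l"
      using safe right(2) u_eq_iff[OF i(1) j] u_eq_iff[OF i(1) l1(1)] u_eq_iff[OF i(1) l1(2)] i that by auto
    obtain m' r' where m': "x (i - 1) \<le> m'" "m' \<le> x i" "best_response A uR F m' r'"
      "\<And>\<omega>. payoff uS F r' \<omega> = u i" "i = l \<Longrightarrow> m' = 1"
      using constant_message[OF small F i(1)] i(2) by metis
    have k: "1 \<le> k" "k < l" using right(3) j by auto
    have V': "0 < (V - u k) * (u (Suc k) - V)" using right(4,5) by (simp add: mult_neg_neg)
    \<comment> \<open>Mirror image: calibrated in state \<open>True\<close>; utility falls across
      the cutoff, so dominance favours state \<open>False\<close>.\<close>
    obtain m r where m: "m \<in> {0<..<1}" "\<bar>m - x k\<bar> \<le> 2 * \<delta>" "best_response A uR F m r"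
      "payoff uS F r True = V"
      "0 \<le> (u (Suc k) - u k) * (payoff uS F r True - payoff uS F r False)"
      using payoff_near_cutoff[OF F d k _ _ V', of True] gap[of k] gap[of "Suc k"] k by auto
    have ge: "V \<le> payoff uS F r False"
      using m(4,5) right(4,5) by (simp add: zero_le_mult_iff)
    have "x j \<le> x (i - 1)" "x k \<le> x (j - 1)" "x i \<le> 1"
      using right(1,3) j cutoff_le_iff[of j "i - 1"] cutoff_le_iff[of k "j - 1"] cutoff_le_iff[of i l] cutoffs(2)
      by auto
    then have mm: "0 \<le> m" "m < \<pi>" "\<pi> < m'" "m' \<le> 1" using m m' prior pg by (auto simp: abs_le_iff)
    have "(1 - \<pi>) * payoff uS F r False + \<pi> * payoff uS F r' True \<le> equilibrium_value A uR uS F \<pi>"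
    proof (rule equilibrium_value_ge[OF I \<pi> two_message_equilibrium[OF m(3) m'(3) \<pi> mm]])
      assume "m' < 1"
      then have "F = uninformative" using un m'(5) by force
      then have "payoff uS F r True = payoff uS F r False" by (simp add: payoff_uninformative)
      then show "payoff uS F r False \<le> payoff uS F r' False" using m(4) m'(4) right(2) by simp
    qed (use m m' ge right(2) in auto)
    moreover have "(1 - \<pi>) * V + \<pi> * V \<le> (1 - \<pi>) * payoff uS F r False + \<pi> * payoff uS F r' True"
      using m'(4) right(2) ge \<pi> by (intro add_mono mult_left_mono) auto
    ultimately show ?thesis by (simp add: algebra_simps)
  qed
qed

section \<open>Upper bounds: no information and binary signals\<close>

text \<open>The bound on the belief is \<open>x j\<close> and not the prior, since a signal may
  carry a left message past the prior, though not beyond its interval.\<close>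

lemma mixed_utility_le_left:
  assumes "set_pmf \<alpha> \<subseteq> best_replies A uR q" "0 \<le> q" "q < x j"
  shows "mixed_utility uS \<alpha> \<le> left_value"
proof (rule mixed_utility_le)
  show "set_pmf \<alpha> \<subseteq> a ` {1..j}"
  proof (rule subset_trans[OF assms(1)], rule subsetI)
    fix b assume b: "b \<in> best_replies A uR q"
    have "x j \<le> 1" using cutoff_le_iff[of j l] j cutoffs by simp
    then obtain k where k: "k \<in> {1..l}" "b = a k" "x (k - 1) \<le> q"
      using best_replies_index[OF b] assms by auto
    then have "k - 1 < j" using cutoff_less_iff[of "k - 1" j] assms j by auto
    then show "b \<in> a ` {1..j}" using k by auto
  qed
qed (use u_le_left in auto)

lemma mixed_utility_le_right:
  assumes "set_pmf \<alpha> \<subseteq> best_replies A uR q" "x (j - 1) < q" "q \<le> 1"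
  shows "mixed_utility uS \<alpha> \<le> right_value"
proof (rule mixed_utility_le)
  show "set_pmf \<alpha> \<subseteq> a ` {j..l}"
  proof (rule subset_trans[OF assms(1)], rule subsetI)
    fix b assume b: "b \<in> best_replies A uR q"
    have "0 \<le> x (j - 1)" using j by (intro cutoff_bounds) auto
    then obtain k where k: "k \<in> {1..l}" "b = a k" "q \<le> x k"
      using best_replies_index[OF b] assms by auto
    then have "j - 1 < k" using cutoff_less_iff[of "j - 1" k] assms j by auto
    then show "b \<in> a ` {j..l}" using k by auto
  qed
qed (use u_le_right in auto)

lemma uninformed_value_eq: "uninformed_value A uR uS \<pi> = V"
proof (rule antisym)
  obtain \<delta> where \<delta>: "small \<delta>"
    using eventually_happens'[OF trivial_limit_at_right_real eventually_small] by blast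
  then show "V \<le> uninformed_value A uR uS \<pi>"
    unfolding uninformed_value_def
    by (intro equilibrium_value_ge_V uninformative_near) (auto simp: small_def)
  show "uninformed_value A uR uS \<pi> \<le> V"
    unfolding uninformed_value_def
  proof (rule equilibrium_value_le[OF info_structure_uninformative prior_bounds])
    fix M \<sigma> \<rho> assume eq: "cheap_talk_equilibrium A uR uS uninformative \<pi> M \<sigma> \<rho>"
    obtain W m m' where m: "m \<in> M" "m' \<in> M" "0 \<le> m" "m \<le> \<pi>" "\<pi> \<le> m'" "m' \<le> 1"
      and W: "\<And>\<omega>. payoff uS uninformative (\<rho> m) \<omega> \<le> W \<omega>"
        "\<And>\<omega>. payoff uS uninformative (\<rho> m') \<omega> \<le> W \<omega>"
        "payoff uS uninformative (\<rho> m) False = W False"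
        "payoff uS uninformative (\<rho> m') True = W True"
      and ex: "ex_ante_utility uS uninformative \<pi> M \<sigma> \<rho> = (1 - \<pi>) * W False + \<pi> * W True"
      by (rule equilibrium_messages[OF eq prior_bounds]) blast
    have sub: "set_pmf (\<rho> n (1/2)) \<subseteq> best_replies A uR n" if "n \<in> M" for n
      using equilibrium_best_response[OF eq that] by (simp add: best_response_def uninformative_def)
    have "mixed_utility uS (\<rho> m (1/2)) \<le> left_value"
      using m prior by (intro mixed_utility_le_left[OF sub]) auto
    moreover have "mixed_utility uS (\<rho> m' (1/2)) \<le> right_value"
      using m prior by (intro mixed_utility_le_right[OF sub]) auto
    \<comment> \<open>Without information a message is worth the same in both states, so the
      optimality conditions of the two states bound \<open>W False\<close> and \<open>W True\<close>
      by each other.\<close>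
    ultimately have "W False = W True" "W True \<le> V"
      using W(1)[of True] W(2)[of False] W(3,4) by (auto simp: payoff_uninformative V_def)
    then show "ex_ante_utility uS uninformative \<pi> M \<sigma> \<rho> \<le> V" unfolding ex by (simp add: algebra_simps)
  qed
qed

lemma sender_values_prior: "sender_values A uR uS \<pi> = {u j}"
proof -
  have b: "best_replies A uR \<pi> = {a j}" by (rule best_replies_interior[OF j prior])
  have "mixed_utility uS (return_pmf (a j)) = u j" by simp
  then show ?thesis
    unfolding sender_values_def b using mixed_utility_singleton[of _ "a j" uS] set_return_pmf[of "a j"]
    by (intro equalityI subsetI) (auto intro!: exI[of _ "return_pmf (a j)"])
qed

text \<open>The two posteriors are too close to each other for both of them to be cutoffs.\<close>

lemma pure_binary_reply:
  assumes small: "small d" and m: "m \<in> {0<..<1}"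
    and r: "best_response A uR (binary_structure d) m r"
  obtains s k where "s \<in> {1/2 - d, 1/2 + d}" "k \<in> {1..l}" "mixed_utility uS (r s) = u k"
    "x (k - 1) < update m s" "update m s < x k"
proof -
  let ?lo = "1/2 - d" and ?hi = "1/2 + d"
  have d: "0 < d" "d \<le> 1/8" and gap: "\<And>k. k \<in> {1..l} \<Longrightarrow> x (k - 1) + 4 * d < x k"
    using small by (auto simp: small_def)
  have int: "update m s \<in> {0<..<1}" if "s \<in> {?lo, ?hi}" for s
    using that m d by (intro update_interior) auto
  have near: "\<bar>update m s - m\<bar> \<le> 2 * d" if "s \<in> {?lo, ?hi}" for s
    using that m d by (intro update_near) auto
  have mono: "update m ?lo < update m ?hi"
    using m d by (intro update_strict_mono) auto
  have "\<exists>s\<in>{?lo, ?hi}. update m s \<notin> x ` {0..l}"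
  proof (rule ccontr)
    assume "\<not> ?thesis"
    then obtain i k where ik: "i \<le> l" "k \<le> l" "update m ?lo = x i" "update m ?hi = x k"
      by (auto simp: image_iff)
    then have "i < k" using mono cutoff_less_iff by simp
    then have "x i \<le> x (k - 1)" using ik by (subst cutoff_le_iff) auto
    moreover have "x (k - 1) + 4 * d < x k" using gap \<open>i < k\<close> ik by auto
    ultimately show False using near[of ?lo] near[of ?hi] ik by (simp add: abs_le_iff)
  qed
  then obtain s where s: "s \<in> {?lo, ?hi}" "update m s \<notin> x ` {0..l}" by blast
  have "update m s \<in> {0..1}" using int[OF s(1)] by simp
  then obtain k where k: "k \<in> {1..l}" "x (k - 1) \<le> update m s" "update m s \<le> x k"
    using best_replies_index[OF reply_best] by metis
  have "x (k - 1) \<in> x ` {0..l}" "x k \<in> x ` {0..l}" using k by auto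
  then have kk: "x (k - 1) < update m s" "update m s < x k"
    using k s(2) by (metis less_le)+
  have "set_pmf (r s) \<subseteq> best_replies A uR (update m s)"
    using r s(1) by (auto simp: best_response_def space_binary_structure)
  then have "set_pmf (r s) \<subseteq> {a k}" unfolding best_replies_interior[OF k(1) kk] .
  then show ?thesis using that[OF s(1) k(1) mixed_utility_singleton kk] by simp
qed

text \<open>\<open>g\<close> bounds from below the gap between \<open>V\<close> and every smaller
  utility. A revealing message is worth an extreme action, hence at most \<open>V - g\<close>, and
  \<open>d\<close> is so small that the other state gains at most \<open>g / 2\<close> on this. If
  no message reveals a state, some signal costs \<open>g\<close>, and each has probability at least
  1/4.\<close>

lemma binary_equilibrium_le:
  assumes small: "small d" and V: "V \<noteq> u j" "V \<noteq> u 1" "V \<noteq> u l"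
    and g: "\<And>k. k \<in> {1..l} \<Longrightarrow> u k < V \<Longrightarrow> u k \<le> V - g" and g0: "0 < g"
    and d': "8 * d * utility_bound \<le> g"
    and eq: "cheap_talk_equilibrium A uR uS (binary_structure d) \<pi> M \<sigma> \<rho>"
  shows "ex_ante_utility uS (binary_structure d) \<pi> M \<sigma> \<rho> \<le> V - g / 4"
proof -
  let ?F = "binary_structure d" and ?lo = "1/2 - d" and ?hi = "1/2 + d"
  let ?p = "\<lambda>n. payoff uS ?F (\<rho> n)" and ?h = "\<lambda>n s. mixed_utility uS (\<rho> n s)"
  have d: "0 < d" "d < 1/2" "d \<le> 1/8" and pg: "x (j - 1) + 2 * d < \<pi>" "\<pi> + 2 * d < x j"
    using small by (auto simp: small_def)
  note I = binary_structure_info[OF d(1,2)]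
  obtain W m m' where m: "m \<in> M" "m' \<in> M" "0 \<le> m" "m \<le> \<pi>" "\<pi> \<le> m'" "m' \<le> 1"
    and W: "\<And>\<omega>. ?p m \<omega> \<le> W \<omega>" "\<And>\<omega>. ?p m' \<omega> \<le> W \<omega>"
      "?p m False = W False" "?p m' True = W True"
    and W0: "0 < m \<Longrightarrow> ?p m True = W True" and W1: "m' < 1 \<Longrightarrow> ?p m' False = W False"
    and ex: "ex_ante_utility uS ?F \<pi> M \<sigma> \<rho> = (1 - \<pi>) * W False + \<pi> * W True"
    by (rule equilibrium_messages[OF eq prior_bounds]) blast
  have r: "best_response A uR ?F m (\<rho> m)" "best_response A uR ?F m' (\<rho> m')"
    using equilibrium_best_response[OF eq] m by auto
  have pF: "?p n False = ?hi * ?h n ?lo + ?lo * ?h n ?hi" for n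
    unfolding payoff_def integral_binary_structure[OF d(1,2)] by (simp add: weight_def)
  have pT: "?p n True = ?lo * ?h n ?lo + ?hi * ?h n ?hi" for n
    unfolding payoff_def integral_binary_structure[OF d(1,2)] by (simp add: weight_def)
  have sub: "set_pmf (\<rho> n s) \<subseteq> best_replies A uR (update n s)" if "n \<in> {m, m'}" "s \<in> {?lo, ?hi}" for n s
    using r that by (auto simp: best_response_def space_binary_structure)
  have near: "\<bar>update n s - n\<bar> \<le> 2 * d" if "n \<in> {m, m'}" "s \<in> {?lo, ?hi}" for n s
    using that m d prior_bounds by (intro update_near) auto
  have bounds: "update n s \<in> {0..1}" if "n \<in> {m, m'}" "s \<in> {?lo, ?hi}" for n s
    using that m d prior_bounds by (intro update_bounds) auto
  have left: "update m s < x j" "?h m s \<le> left_value" if "s \<in> {?lo, ?hi}" for s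
  proof -
    show *: "update m s < x j" using near[of m s] that m pg by (auto simp: abs_le_iff)
    show "?h m s \<le> left_value"
      using bounds[of m s] that by (intro mixed_utility_le_left[OF sub _ *]) auto
  qed
  have right: "x (j - 1) < update m' s" "?h m' s \<le> right_value" if "s \<in> {?lo, ?hi}" for s
  proof -
    show *: "x (j - 1) < update m' s" using near[of m' s] that m pg by (auto simp: abs_le_iff)
    show "?h m' s \<le> right_value"
      using bounds[of m' s] that by (intro mixed_utility_le_right[OF sub * ]) auto
  qed
  have avg: "?hi * y + ?lo * z \<le> c" "?lo * y + ?hi * z \<le> c" if "y \<le> c" "z \<le> c" for y z c :: real
    using that d by (auto intro!: convex_bound_le)
  have pleft: "?p m \<omega> \<le> left_value" for \<omega>
    using left(2)[of ?lo] left(2)[of ?hi] by (cases \<omega>) (auto simp: pF pT intro!: avg)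
  have pright: "?p m' \<omega> \<le> right_value" for \<omega>
    using right(2)[of ?lo] right(2)[of ?hi] by (cases \<omega>) (auto simp: pF pT intro!: avg)
  have hB: "\<bar>?h n s\<bar> \<le> utility_bound" if "n \<in> {m, m'}" "s \<in> {?lo, ?hi}" for n s
    by (rule mixed_utility_abs_le[OF subset_trans[OF sub[OF that] best_replies_subset] finite_A utility_bound])
  \<comment> \<open>The probability of each signal changes by only \<open>2 * d\<close> between the
    states, while replies differ in utility by at most twice \<open>utility_bound\<close>.\<close>
  have close: "\<bar>?p n True - ?p n False\<bar> \<le> g / 2" if n: "n \<in> {m, m'}" for n
  proof -
    have "?p n True - ?p n False = 2 * d * (?h n ?hi - ?h n ?lo)"
      by (simp add: pF pT algebra_simps)
    then have "\<bar>?p n True - ?p n False\<bar> = 2 * d * \<bar>?h n ?hi - ?h n ?lo\<bar>"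
      using d by (simp add: abs_mult)
    also have "\<dots> \<le> 2 * d * (2 * utility_bound)"
      using hB[OF n, of ?lo] hB[OF n, of ?hi] d by (intro mult_left_mono) (auto simp: abs_le_iff)
    also have "\<dots> \<le> g / 2" using d' by simp
    finally show ?thesis .
  qed
  have l: "1 \<in> {1..l}" "l \<in> {1..l}" using l_pos by auto
  have u1: "u 1 \<le> left_value" and ul: "u l \<le> right_value"
    using u_le_left[of 1] u_le_right[of l] j by auto
  have p0: "?p m \<omega> = u 1" if "m = 0" for \<omega>
    using payoff_0[OF I] r(1) that by simp
  have p1: "?p m' \<omega> = u l" if "m' = 1" for \<omega>
    using payoff_1[OF I] r(2) that by simp
  have "W False \<le> V - g / 4 \<and> W True \<le> V - g / 4"
  proof -
    consider "m = 0" "m' = 1" | "m = 0" "m' < 1" | "0 < m" "m' = 1" | "0 < m" "m' < 1"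
      using m by fastforce
    then show ?thesis
    proof cases
      case 1
      \<comment> \<open>Under full revelation neither state gains by imitating the other, which
        forces \<open>u 1 = u l\<close>.\<close>
      then have "W False = u 1" "W True = u l" "u l \<le> W False" "u 1 \<le> W True"
        using W p0 p1 by metis+
      then have "W False = u 1" "W True = u 1" "u 1 \<le> V" using u1 ul by (auto simp: V_def)
      then show ?thesis using g[OF l(1)] V(2) g0 by auto
    next
      case 2
      have "W False = u 1" using W(3) p0[OF 2(1)] by simp
      moreover have "W False = ?p m' False" using W1 2 by simp
      ultimately have "u 1 \<le> V" "W False = u 1"
        using u1 pright[of False] by (auto simp: V_def)
      then have "W False \<le> V - g" using g[OF l(1)] V(2) by simp
      moreover have "W True \<le> W False + g / 2"
        using abs_le_D1[OF close[of m']] W(4) W1 2 by simp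
      ultimately show ?thesis using g0 by auto
    next
      case 3
      have "W True = u l" using W(4) p1[OF 3(2)] by simp
      moreover have "W True = ?p m True" using W0 3 by simp
      ultimately have "u l \<le> V" "W True = u l"
        using ul pleft[of True] by (auto simp: V_def)
      then have "W True \<le> V - g" using g[OF l(2)] V(3) by simp
      moreover have "W False \<le> W True + g / 2"
        using abs_le_D2[OF close[of m]] W(3) W0 3 by simp
      ultimately show ?thesis using g0 by auto
    next
      case 4
      have m01: "m \<in> {0<..<1}" "m' \<in> {0<..<1}" using 4 m prior_bounds by auto
      have e: "?p m False = ?p m' False" "?p m True = ?p m' True"
        using W(3,4) W0 W1 4 by auto
      text \<open>With two signals, the two interim utilities determine the utility after each signal.\<close>
      have "?p m True + ?p m False = ?p m' True + ?p m' False" using e by simp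
      then have s: "?h m ?lo + ?h m ?hi = ?h m' ?lo + ?h m' ?hi"
        by (simp add: pF pT algebra_simps)
      have "?p m True - ?p m False = ?p m' True - ?p m' False" using e by simp
      then have "2 * d * (?h m ?hi - ?h m ?lo) = 2 * d * (?h m' ?hi - ?h m' ?lo)"
        by (simp add: pF pT algebra_simps)
      then have "?h m ?hi - ?h m ?lo = ?h m' ?hi - ?h m' ?lo" using d by simp
      with s have h: "?h m s = ?h m' s" if "s \<in> {?lo, ?hi}" for s using that by auto
      \<comment> \<open>The common utility after each signal is attainable on both sides of the
        prior, hence below both maxima.\<close>
      have hV: "?h m s \<le> V" if "s \<in> {?lo, ?hi}" for s
        using left(2)[OF that] right(2)[OF that] h[OF that] by (simp add: V_def)
      obtain s k where s: "s \<in> {?lo, ?hi}" "k \<in> {1..l}" "?h m s = u k" "x (k - 1) < update m s"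
        using pure_binary_reply[OF small m01(1) r(1)] by metis
      obtain s' k' where s': "s' \<in> {?lo, ?hi}" "k' \<in> {1..l}" "?h m' s' = u k'" "update m' s' < x k'"
        using pure_binary_reply[OF small m01(2) r(2)] by metis
      have "x (k - 1) < x j" "x (j - 1) < x k'"
        using left(1)[OF s(1)] s(4) right(1)[OF s'(1)] s'(4) by auto
      moreover have "k - 1 \<le> l" "j \<le> l" "j - 1 \<le> l" "k' \<le> l" using s(2) s'(2) j by auto
      ultimately have "k - 1 < j" "j - 1 < k'" by (auto simp only: cutoff_less_iff)
      then have kj: "k \<le> j" "j \<le> k'" by auto
      \<comment> \<open>If both were \<open>V\<close>, genericity would give \<open>k = k'\<close>,
        so both would be \<open>j\<close>, contradicting \<open>V \<noteq> u j\<close>.\<close>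
      have "u k \<noteq> V \<or> u k' \<noteq> V"
        using u_eq_iff[OF s(2) s'(2)] kj V(1) by (metis le_antisym)
      then obtain t where t: "t \<in> {?lo, ?hi}" "?h m t \<le> V - g"
        using g[OF s(2)] g[OF s'(2)] hV[OF s(1)] hV[OF s'(1)] h[OF s'(1)] s s' by (metis less_le)
      have bound: "c * y + c' * z \<le> V - g / 4"
        if "y \<le> V" "z \<le> V" "y \<le> V - g \<or> z \<le> V - g" "1/4 \<le> c" "1/4 \<le> c'" "c + c' = 1" for c c' y z
      proof -
        have "0 \<le> c * (V - y)" "0 \<le> c' * (V - z)" using that by auto
        moreover have "g / 4 \<le> c * (V - y) \<or> g / 4 \<le> c' * (V - z)"
          using that(3)
        proof
          assume "y \<le> V - g"
          then have "1/4 * g \<le> c * (V - y)" using that g0 by (intro mult_mono) auto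
          then show ?thesis by simp
        next
          assume "z \<le> V - g"
          then have "1/4 * g \<le> c' * (V - z)" using that g0 by (intro mult_mono) auto
          then show ?thesis by simp
        qed
        moreover have "c * y + c' * z = (c + c') * V - c * (V - y) - c' * (V - z)"
          by (simp add: algebra_simps)
        ultimately show ?thesis using that(6) by auto
      qed
      have "?h m ?lo \<le> V - g \<or> ?h m ?hi \<le> V - g" using t by auto
      then have "?p m False \<le> V - g / 4" "?p m True \<le> V - g / 4"
        unfolding pF pT using hV d by (auto intro!: bound)
      then show ?thesis using W(3) W0 4 by simp
    qed
  qed
  then show ?thesis unfolding ex using prior_bounds by (intro convex_bound_le) auto
qed

section \<open>The limit of the worst case as signals become uninformative\<close>

abbreviation robust_inf :: "real \<Rightarrow> real" where
  "robust_inf \<delta> \<equiv> INF F\<in>near_uninformative \<delta>. equilibrium_value A uR uS F \<pi>"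

lemma robust_inf_bdd: "bdd_below ((\<lambda>F. equilibrium_value A uR uS F \<pi>) ` near_uninformative \<delta>)"
  using equilibrium_value_lower_bound[OF near_uninformativeD(1) prior_bounds]
  by (intro bdd_belowI2[of _ "- utility_bound"])

lemma robust_inf_le: "F \<in> near_uninformative \<delta> \<Longrightarrow> robust_inf \<delta> \<le> equilibrium_value A uR uS F \<pi>"
  by (rule cINF_lower[OF robust_inf_bdd])

lemma robust_inf_antimono:
  assumes "0 < \<delta>" "\<delta> \<le> \<delta>'"
  shows "robust_inf \<delta>' \<le> robust_inf \<delta>"
proof (rule cINF_superset_mono[OF _ robust_inf_bdd])
  show "near_uninformative \<delta> \<noteq> {}" using uninformative_near[of \<delta>] assms by auto
  have "{1/2 - \<delta>..1/2 + \<delta>} \<subseteq> {1/2 - \<delta>'..1/2 + \<delta>'}" using assms by auto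
  note trans = subset_trans[OF _ this]
  show "near_uninformative \<delta> \<subseteq> near_uninformative \<delta>'"
    unfolding near_uninformative_def by (intro Collect_mono impI conjI allI trans; elim conjE allE)
qed auto

text \<open>For small \<open>\<delta>\<close> the infimum is exactly \<open>V\<close>: no structure
  in the class does worse, and the uninformative one attains it.\<close>

lemma robust_value_eq_V:
  assumes "V = u j \<or> (\<exists>i\<in>{1, l}. V = u i)"
  shows "robust_value A uR uS \<pi> = V"
proof -
  have "\<forall>\<^sub>F \<delta> in at_right 0. robust_inf \<delta> = V"
    using eventually_small
  proof eventually_elim
    case (elim \<delta>)
    have un: "uninformative \<in> near_uninformative \<delta>"
      using elim by (intro uninformative_near) (simp add: small_def)
    have "robust_inf \<delta> \<le> V"
      using robust_inf_le[OF un] uninformed_value_eq by (simp add: uninformed_value_def)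
    moreover have "V \<le> robust_inf \<delta>"
      using un assms by (intro cINF_greatest equilibrium_value_ge_V[OF elim]) auto
    ultimately show ?case by simp
  qed
  then show ?thesis
    unfolding robust_value_def by (intro tendsto_Lim tendsto_eventually) auto
qed

text \<open>Every class contains arbitrarily weak binary structures, and their loss
  \<open>g / 4\<close> does not shrink with \<open>\<delta>\<close>. Monotonicity in
  \<open>\<delta>\<close> makes the limit exist, so the bound passes to it.\<close>

lemma robust_value_less_V:
  assumes V: "V \<noteq> u j" "V \<noteq> u 1" "V \<noteq> u l"
  shows "robust_value A uR uS \<pi> < V"
proof -
  \<comment> \<open>The element 1 keeps the set nonempty, and the minimum positive, even if no
    action has utility below \<open>V\<close>.\<close>
  define G where "G = insert 1 ((\<lambda>k. V - u k) ` {k \<in> {1..l}. u k < V})"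
  define g where "g = Min G"
  have G: "finite G" "G \<noteq> {}" by (auto simp: G_def)
  have g0: "0 < g" unfolding g_def using G by (subst Min_gr_iff) (auto simp: G_def)
  have g: "u k \<le> V - g" if "k \<in> {1..l}" "u k < V" for k
  proof -
    have "g \<le> V - u k" unfolding g_def using that G by (intro Min_le) (auto simp: G_def)
    then show ?thesis by simp
  qed
  have "\<forall>\<^sub>F d in at_right 0. d < g / (8 * (\<bar>utility_bound\<bar> + 1))"
    using g0 by (intro eventually_at_right_0_less) simp
  then have "\<forall>\<^sub>F d in at_right 0. 8 * d * utility_bound \<le> g"
    using eventually_at_right_less[of "0::real"]
  proof eventually_elim
    case (elim d)
    have "8 * d * utility_bound \<le> 8 * d * (\<bar>utility_bound\<bar> + 1)"
      using elim by (intro mult_left_mono) auto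
    also have "\<dots> \<le> g"
    proof -
      have "0 < 8 * (\<bar>utility_bound\<bar> + 1)" by simp
      then have "d * (8 * (\<bar>utility_bound\<bar> + 1)) < g" using elim(1) by (simp only: pos_less_divide_eq)
      then show ?thesis by (simp add: algebra_simps)
    qed
    finally show ?case .
  qed
  then have ok: "\<forall>\<^sub>F d in at_right 0. 8 * d * utility_bound \<le> g \<and> small d"
    using eventually_small by (rule eventually_conj)
  have le: "robust_inf \<delta> \<le> V - g / 4" if \<delta>: "0 < \<delta>" for \<delta>
  proof -
    have "\<forall>\<^sub>F d in at_right 0. d < \<delta>"
      using \<delta> by (rule eventually_at_right_0_less)
    with ok have "\<forall>\<^sub>F d in at_right 0. (8 * d * utility_bound \<le> g \<and> small d) \<and> d < \<delta>"
      by (rule eventually_conj)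
    then obtain d where d: "8 * d * utility_bound \<le> g" "small d" "d < \<delta>"
      using eventually_happens'[OF trivial_limit_at_right_real] by blast
    have d2: "0 < d" "d < 1/2" using d(2) by (auto simp: small_def)
    have "robust_inf \<delta> \<le> equilibrium_value A uR uS (binary_structure d) \<pi>"
      using d2 d(3) by (intro robust_inf_le binary_structure_near) auto
    also have "\<dots> \<le> V - g / 4"
      by (rule equilibrium_value_le[OF binary_structure_info[OF d2] prior_bounds
            binary_equilibrium_le[OF d(2) V g g0 d(1)]])
    finally show ?thesis .
  qed
  \<comment> \<open>The infimum grows as \<open>\<delta>\<close> decreases, so its limit at 0 is its
    supremum.\<close>
  define S where "S = (SUP \<delta>\<in>{0<..}. robust_inf \<delta>)"
  have bdd: "bdd_above (robust_inf ` {0<..})" using le by (intro bdd_aboveI2[of _ _ "V - g / 4"]) auto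
  have "(robust_inf \<longlongrightarrow> S) (at_right 0)"
  proof (rule increasing_tendsto)
    show "\<forall>\<^sub>F \<delta> in at_right 0. robust_inf \<delta> \<le> S"
      using eventually_at_right_less[of "0::real"]
      by eventually_elim (auto simp: S_def intro!: cSUP_upper bdd)
  next
    fix y assume "y < S"
    then obtain \<delta> where \<delta>: "0 < \<delta>" "y < robust_inf \<delta>"
      unfolding S_def using less_cSUP_iff[OF _ bdd, of y] by auto
    have "\<forall>\<^sub>F d in at_right 0. d \<in> {0<..<\<delta>}" using \<delta>(1) by (rule eventually_at_right_real)
    then show "\<forall>\<^sub>F d in at_right 0. y < robust_inf d"
    proof eventually_elim
      case (elim d)
      then show ?case using robust_inf_antimono[of d \<delta>] \<delta>(2) by simp
    qed
  qed
  then have "robust_value A uR uS \<pi> = S" unfolding robust_value_def by (intro tendsto_Lim) auto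
  moreover have "S \<le> V - g / 4" unfolding S_def using le by (intro cSUP_least) auto
  ultimately show ?thesis using g0 by simp
qed

end

theorem theorem1:
  fixes A :: "'a set" and a :: "nat \<Rightarrow> 'a" and l j :: nat and x :: "nat \<Rightarrow> real"
    and uR :: "'a \<Rightarrow> bool \<Rightarrow> real" and uS :: "'a \<Rightarrow> real" and \<pi> :: real
  assumes actions: "bij_betw a {1..l} A"
    and cutoffs: "x 0 = 0" "x l = 1" "strict_mono_on {0..l} x"
    and optimal: "\<And>i. i \<in> {1..l} \<Longrightarrow> {q \<in> {0..1}. a i \<in> best_replies A uR q} = {x (i - 1)..x i}"
    and generic: "inj_on uS A"
    and "j \<in> {1..l}"
    and "\<pi> \<in> {0<..<1}" "\<pi> \<in> interior {x (j - 1)..x j}"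
  shows "robust_value A uR uS \<pi> = uninformed_value A uR uS \<pi> \<longleftrightarrow>
           sender_values A uR uS \<pi> = {uninformed_value A uR uS \<pi>} \<or>
           (\<exists>i\<in>{1, l}. uninformed_value A uR uS \<pi> = uS (a i))"
proof -
  interpret cheap_talk_prior A a l x uR uS j \<pi>
    using assms by unfold_locales auto
  have "robust_value A uR uS \<pi> = V \<longleftrightarrow> V = uS (a j) \<or> (\<exists>i\<in>{1, l}. V = uS (a i))"
    using robust_value_eq_V robust_value_less_V by fastforce
  \<comment> \<open>At the prior \<open>v\<close> is the single value \<open>u j\<close>, so trivial
    support means \<open>V = u j\<close>.\<close>
  then show ?thesis unfolding uninformed_value_eq sender_values_prior by auto
qed

end
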